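(* Let $X$ be a quasicompact scheme with only finitely many connected components, written $X = X_1\coprod\cdots\coprod X_n$ (the $X_j$ being the connected components). The following are equivalent. (a) $X$ is locally unit-additive. (b) Each $X_j$ is locally unit-additive. If $X$ is itself affine, then another equivalent condition is: (c) Each $X_j$ is unit-additive.
   Context: Rings are commutative with identity. A ring is unit-additive if for all units $u,v$ of the ring, $u+v$ is a unit or nilpotent (the zero ring is unit-additive). An affine scheme is unit-additive if it is the spectrum of a unit-additive ring. A scheme is locally unit-additive if it has a cover by affine open unit-additive subschemes. *)

theory Defs
  imports "HOL-Algebra.QuotRing" "HOL-Analysis.Abstract_Topological_Spaces"
begin

section \<open>Unit-additive rings\<close>

definition nilpotent_elem :: "('r, 'm) ring_scheme \<Rightarrow> 'r \<Rightarrow> bool"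
  where "nilpotent_elem R x \<longleftrightarrow> x \<in> carrier R \<and> (\<exists>n::nat. 0 < n \<and> x [^]\<^bsub>R\<^esub> n = \<zero>\<^bsub>R\<^esub>)"

definition unit_additive_ring :: "('r, 'm) ring_scheme \<Rightarrow> bool"
  where "unit_additive_ring R \<longleftrightarrow> cring R \<and>
    (\<forall>u\<in>Units R. \<forall>v\<in>Units R. u \<oplus>\<^bsub>R\<^esub> v \<in> Units R \<or> nilpotent_elem R (u \<oplus>\<^bsub>R\<^esub> v))"

definition local_ring :: "('r, 'm) ring_scheme \<Rightarrow> bool"
  where "local_ring R \<longleftrightarrow> cring R \<and> (\<exists>!M. maximalideal M R)"


section \<open>Localization\<close>

text \<open>The elements of \<open>S\<inverse>R\<close> are the equivalence classes of pairs \<open>(a, s)\<close>, to be read as \<open>a/s\<close>.\<close>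

definition loc_rel :: "('r, 'm) ring_scheme \<Rightarrow> 'r set \<Rightarrow> (('r \<times> 'r) \<times> ('r \<times> 'r)) set"
  where "loc_rel R S = {((a, s), (b, t)).
    a \<in> carrier R \<and> s \<in> S \<and> b \<in> carrier R \<and> t \<in> S \<and>
    (\<exists>u\<in>S. u \<otimes>\<^bsub>R\<^esub> (t \<otimes>\<^bsub>R\<^esub> a \<ominus>\<^bsub>R\<^esub> s \<otimes>\<^bsub>R\<^esub> b) = \<zero>\<^bsub>R\<^esub>)}"

definition fraction :: "('r, 'm) ring_scheme \<Rightarrow> 'r set \<Rightarrow> 'r \<Rightarrow> 'r \<Rightarrow> ('r \<times> 'r) set"
  where "fraction R S a s = loc_rel R S `` {(a, s)}"

text \<open>Addition and multiplication take the union over all representatives; as these operations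
  are compatible with the equivalence relation, this union is a single equivalence class.\<close>

definition localization :: "('r, 'm) ring_scheme \<Rightarrow> 'r set \<Rightarrow> ('r \<times> 'r) set ring"
  where "localization R S =
    \<lparr> carrier = (carrier R \<times> S) // loc_rel R S,
      mult = (\<lambda>X Y. \<Union>(a, s)\<in>X. \<Union>(b, t)\<in>Y. fraction R S (a \<otimes>\<^bsub>R\<^esub> b) (s \<otimes>\<^bsub>R\<^esub> t)),
      one = fraction R S \<one>\<^bsub>R\<^esub> \<one>\<^bsub>R\<^esub>,
      zero = fraction R S \<zero>\<^bsub>R\<^esub> \<one>\<^bsub>R\<^esub>,
      add = (\<lambda>X Y. \<Union>(a, s)\<in>X. \<Union>(b, t)\<in>Y.
               fraction R S (t \<otimes>\<^bsub>R\<^esub> a \<oplus>\<^bsub>R\<^esub> s \<otimes>\<^bsub>R\<^esub> b) (s \<otimes>\<^bsub>R\<^esub> t)) \<rparr>"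

abbreviation loc_at :: "('r, 'm) ring_scheme \<Rightarrow> 'r set \<Rightarrow> ('r \<times> 'r) set ring"
  where "loc_at R p \<equiv> localization R (carrier R - p)"

abbreviation fraction_at :: "('r, 'm) ring_scheme \<Rightarrow> 'r set \<Rightarrow> 'r \<Rightarrow> 'r \<Rightarrow> ('r \<times> 'r) set"
  where "fraction_at R p \<equiv> fraction R (carrier R - p)"


section \<open>Ringed spaces\<close>

text \<open>\<open>sections X U\<close> is the ring of sections over \<open>U\<close> and \<open>rest X U V\<close> is the restriction map from
  \<open>U\<close> to \<open>V\<close>. Both are meaningful only for open sets \<open>V \<subseteq> U\<close>. All rings of sections have their
  elements in one common type.\<close>

record ('a, 'b) ringed_space =
  points :: "'a topology"
  sections :: "'a set \<Rightarrow> 'b ring"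
  rest :: "'a set \<Rightarrow> 'a set \<Rightarrow> 'b \<Rightarrow> 'b"

definition presheaf_of_rings :: "('a, 'b) ringed_space \<Rightarrow> bool"
  where "presheaf_of_rings X \<longleftrightarrow>
    (\<forall>U. openin (points X) U \<longrightarrow> cring (sections X U)) \<and>
    (\<forall>U V. openin (points X) U \<and> openin (points X) V \<and> V \<subseteq> U \<longrightarrow>
       rest X U V \<in> ring_hom (sections X U) (sections X V)) \<and>
    (\<forall>U. openin (points X) U \<longrightarrow> (\<forall>s\<in>carrier (sections X U). rest X U U s = s)) \<and>
    (\<forall>U V W. openin (points X) U \<and> openin (points X) V \<and> openin (points X) W \<and>
       W \<subseteq> V \<and> V \<subseteq> U \<longrightarrow>
       (\<forall>s\<in>carrier (sections X U). rest X V W (rest X U V s) = rest X U W s))"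

definition is_ringed_space :: "('a, 'b) ringed_space \<Rightarrow> bool"
  where "is_ringed_space X \<longleftrightarrow> presheaf_of_rings X \<and>
    (\<forall>\<U>. (\<forall>U\<in>\<U>. openin (points X) U) \<longrightarrow>
       (\<forall>s\<in>carrier (sections X (\<Union>\<U>)). \<forall>t\<in>carrier (sections X (\<Union>\<U>)).
          (\<forall>U\<in>\<U>. rest X (\<Union>\<U>) U s = rest X (\<Union>\<U>) U t) \<longrightarrow> s = t) \<and>
       (\<forall>f. (\<forall>U\<in>\<U>. f U \<in> carrier (sections X U)) \<and>
            (\<forall>U\<in>\<U>. \<forall>V\<in>\<U>. rest X U (U \<inter> V) (f U) = rest X V (U \<inter> V) (f V)) \<longrightarrow>
            (\<exists>s\<in>carrier (sections X (\<Union>\<U>)). \<forall>U\<in>\<U>. rest X (\<Union>\<U>) U s = f U)))"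

text \<open>The stalk at \<open>x\<close>, whose elements are germs of sections on open neighbourhoods of \<open>x\<close>.\<close>

definition local_sections :: "('a, 'b) ringed_space \<Rightarrow> 'a \<Rightarrow> ('a set \<times> 'b) set"
  where "local_sections X x =
    {(U, s). openin (points X) U \<and> x \<in> U \<and> s \<in> carrier (sections X U)}"

definition germ_rel ::
    "('a, 'b) ringed_space \<Rightarrow> 'a \<Rightarrow> (('a set \<times> 'b) \<times> ('a set \<times> 'b)) set"
  where "germ_rel X x = {((U, s), (V, t)).
    (U, s) \<in> local_sections X x \<and> (V, t) \<in> local_sections X x \<and>
    (\<exists>W. openin (points X) W \<and> x \<in> W \<and> W \<subseteq> U \<inter> V \<and> rest X U W s = rest X V W t)}"

definition germ :: "('a, 'b) ringed_space \<Rightarrow> 'a \<Rightarrow> 'a set \<Rightarrow> 'b \<Rightarrow> ('a set \<times> 'b) set"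
  where "germ X x U s = germ_rel X x `` {(U, s)}"

definition stalk :: "('a, 'b) ringed_space \<Rightarrow> 'a \<Rightarrow> ('a set \<times> 'b) set ring"
  where "stalk X x =
    \<lparr> carrier = local_sections X x // germ_rel X x,
      mult = (\<lambda>A B. \<Union>(U, s)\<in>A. \<Union>(V, t)\<in>B.
        germ X x (U \<inter> V) (rest X U (U \<inter> V) s \<otimes>\<^bsub>sections X (U \<inter> V)\<^esub> rest X V (U \<inter> V) t)),
      one = germ X x (topspace (points X)) \<one>\<^bsub>sections X (topspace (points X))\<^esub>,
      zero = germ X x (topspace (points X)) \<zero>\<^bsub>sections X (topspace (points X))\<^esub>,
      add = (\<lambda>A B. \<Union>(U, s)\<in>A. \<Union>(V, t)\<in>B.
        germ X x (U \<inter> V) (rest X U (U \<inter> V) s \<oplus>\<^bsub>sections X (U \<inter> V)\<^esub> rest X V (U \<inter> V) t)) \<rparr>"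

definition locally_ringed_space :: "('a, 'b) ringed_space \<Rightarrow> bool"
  where "locally_ringed_space X \<longleftrightarrow>
    is_ringed_space X \<and> (\<forall>x\<in>topspace (points X). local_ring (stalk X x))"

text \<open>For open \<open>U\<close>, this is \<open>U\<close> with the restriction of the structure sheaf: the open subsets of
  \<open>U\<close> are open in \<open>X\<close>, so neither the rings of sections nor the restriction maps change.\<close>

definition open_subspace :: "('a, 'b) ringed_space \<Rightarrow> 'a set \<Rightarrow> ('a, 'b) ringed_space"
  where "open_subspace X U = X \<lparr> points := subtopology (points X) U \<rparr>"

text \<open>An isomorphism consists of a homeomorphism \<open>f\<close> and an isomorphism of sheaves of rings from
  the structure sheaf of \<open>Y\<close> to the direct image of that of \<open>X\<close>. The maps induced on stalks are then
  ring isomorphisms, hence local whenever the stalks are local rings. So between locally ringed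
  spaces these are exactly the isomorphisms of locally ringed spaces.\<close>

definition iso_ringed_spaces ::
    "('a, 'b) ringed_space \<Rightarrow> ('c, 'd) ringed_space \<Rightarrow> ('a \<Rightarrow> 'c) \<Rightarrow> ('c set \<Rightarrow> 'd \<Rightarrow> 'b) \<Rightarrow> bool"
  where "iso_ringed_spaces X Y f \<phi> \<longleftrightarrow>
    homeomorphic_map (points X) (points Y) f \<and>
    (\<forall>V. openin (points Y) V \<longrightarrow>
       \<phi> V \<in> ring_iso (sections Y V) (sections X (f -` V \<inter> topspace (points X)))) \<and>
    (\<forall>V W. openin (points Y) V \<and> openin (points Y) W \<and> W \<subseteq> V \<longrightarrow>
       (\<forall>s\<in>carrier (sections Y V).
          \<phi> W (rest Y V W s) =
          rest X (f -` V \<inter> topspace (points X)) (f -` W \<inter> topspace (points X)) (\<phi> V s)))"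

definition isomorphic_ringed_spaces ::
    "('a, 'b) ringed_space \<Rightarrow> ('c, 'd) ringed_space \<Rightarrow> bool"
  where "isomorphic_ringed_spaces X Y \<longleftrightarrow> (\<exists>f \<phi>. iso_ringed_spaces X Y f \<phi>)"


section \<open>The spectrum of a ring\<close>

definition prime_ideals :: "('r, 'm) ring_scheme \<Rightarrow> 'r set set"
  where "prime_ideals R = {p. primeideal p R}"

definition zero_locus :: "('r, 'm) ring_scheme \<Rightarrow> 'r set \<Rightarrow> 'r set set"
  where "zero_locus R E = {p \<in> prime_ideals R. E \<subseteq> p}"

definition zariski_open :: "('r, 'm) ring_scheme \<Rightarrow> 'r set set \<Rightarrow> bool"
  where "zariski_open R U \<longleftrightarrow> (\<exists>E\<subseteq>carrier R. U = prime_ideals R - zero_locus R E)"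

definition zariski_topology :: "('r, 'm) ring_scheme \<Rightarrow> 'r set topology"
  where "zariski_topology R = topology (zariski_open R)"

lemma istopology_zariski_open: "istopology (zariski_open R)"
  unfolding istopology_def
proof (intro conjI allI impI)
  fix U V assume "zariski_open R U" "zariski_open R V"
  then obtain E F where E: "E \<subseteq> carrier R" "U = prime_ideals R - zero_locus R E"
    and F: "F \<subseteq> carrier R" "V = prime_ideals R - zero_locus R F"
    unfolding zariski_open_def by blast
  let ?G = "(\<lambda>(a, b). a \<otimes>\<^bsub>R\<^esub> b) ` (E \<times> F)"
  have G: "p \<in> U \<inter> V \<longleftrightarrow> \<not> ?G \<subseteq> p" if p: "primeideal p R" for p
  proof -
    interpret primeideal p R by (rule p)
    have "?G \<subseteq> p \<longleftrightarrow> E \<subseteq> p \<or> F \<subseteq> p"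
    proof
      assume G: "?G \<subseteq> p"
      show "E \<subseteq> p \<or> F \<subseteq> p"
      proof (rule ccontr)
        assume "\<not> (E \<subseteq> p \<or> F \<subseteq> p)"
        then obtain a b where ab: "a \<in> E" "a \<notin> p" "b \<in> F" "b \<notin> p" by blast
        then have "a \<otimes>\<^bsub>R\<^esub> b \<in> p" using G by auto
        then show False using I_prime ab E(1) F(1) by blast
      qed
    next
      assume "E \<subseteq> p \<or> F \<subseteq> p"
      then show "?G \<subseteq> p" using E(1) F(1) by (auto intro: I_l_closed I_r_closed)
    qed
    then show ?thesis using p E(2) F(2) by (auto simp: prime_ideals_def zero_locus_def)
  qed
  have "?G \<subseteq> carrier R \<or> prime_ideals R = {}"
  proof (cases "prime_ideals R = {}")
    case False
    then obtain p where "primeideal p R" by (auto simp: prime_ideals_def)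
    then interpret primeideal p R .
    show ?thesis using E(1) F(1) by auto
  qed simp
  moreover have "U \<inter> V = prime_ideals R - zero_locus R ?G"
    using G E(2) F(2) by (auto simp: prime_ideals_def zero_locus_def)
  ultimately show "zariski_open R (U \<inter> V)"
    unfolding zariski_open_def by (metis Diff_empty empty_Diff empty_subsetI)
next
  fix \<U> assume "\<forall>U\<in>\<U>. zariski_open R U"
  then have "\<forall>U\<in>\<U>. \<exists>E. E \<subseteq> carrier R \<and> U = prime_ideals R - zero_locus R E"
    unfolding zariski_open_def by blast
  then obtain E where E: "\<forall>U\<in>\<U>. E U \<subseteq> carrier R \<and> U = prime_ideals R - zero_locus R (E U)"
    by (rule bchoice[THEN exE])
  have "(\<lambda>U. U) ` \<U> = (\<lambda>U. prime_ideals R - zero_locus R (E U)) ` \<U>"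
    by (rule image_cong[OF refl]) (use E in blast)
  then have "\<Union>\<U> = (\<Union>U\<in>\<U>. prime_ideals R - zero_locus R (E U))"
    by simp
  also have "\<dots> = prime_ideals R - zero_locus R (\<Union>U\<in>\<U>. E U)"
    by (simp only: zero_locus_def) fast
  finally have "\<Union>\<U> = prime_ideals R - zero_locus R (\<Union>U\<in>\<U>. E U)" .
  moreover have "(\<Union>U\<in>\<U>. E U) \<subseteq> carrier R"
    using E by (simp add: UN_subset_iff)
  ultimately show "zariski_open R (\<Union>\<U>)"
    unfolding zariski_open_def by (intro exI[of _ "\<Union>U\<in>\<U>. E U"] conjI)
qed

lemma openin_zariski_topology: "openin (zariski_topology R) U \<longleftrightarrow> zariski_open R U"
  by (simp add: zariski_topology_def istopology_zariski_open topology_inverse')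

text \<open>A section over \<open>U\<close> assigns to each prime ideal \<open>p \<in> U\<close> an element of the localization of \<open>R\<close>
  at \<open>p\<close> (and \<open>undefined\<close> outside of \<open>U\<close>) such that it is locally given by a single fraction.\<close>

definition regular_functions ::
    "('r, 'm) ring_scheme \<Rightarrow> 'r set set \<Rightarrow> ('r set \<Rightarrow> ('r \<times> 'r) set) set"
  where "regular_functions R U = {s \<in> (\<Pi>\<^sub>E p\<in>U. carrier (loc_at R p)).
    \<forall>p\<in>U. \<exists>V. zariski_open R V \<and> p \<in> V \<and> V \<subseteq> U \<and>
      (\<exists>a\<in>carrier R. \<exists>g\<in>carrier R. \<forall>q\<in>V. g \<notin> q \<and> s q = fraction_at R q a g)}"

definition structure_ring ::
    "('r, 'm) ring_scheme \<Rightarrow> 'r set set \<Rightarrow> ('r set \<Rightarrow> ('r \<times> 'r) set) ring"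
  where "structure_ring R U =
    \<lparr> carrier = regular_functions R U,
      mult = (\<lambda>s t. \<lambda>p\<in>U. s p \<otimes>\<^bsub>loc_at R p\<^esub> t p),
      one = (\<lambda>p\<in>U. \<one>\<^bsub>loc_at R p\<^esub>),
      zero = (\<lambda>p\<in>U. \<zero>\<^bsub>loc_at R p\<^esub>),
      add = (\<lambda>s t. \<lambda>p\<in>U. s p \<oplus>\<^bsub>loc_at R p\<^esub> t p) \<rparr>"

definition Spec ::
    "('r, 'm) ring_scheme \<Rightarrow> ('r set, 'r set \<Rightarrow> ('r \<times> 'r) set) ringed_space"
  where "Spec R =
    \<lparr> points = zariski_topology R,
      sections = structure_ring R,
      rest = (\<lambda>U V s. restrict s V) \<rparr>"


section \<open>Schemes\<close>

text \<open>In the next two definitions the ring ranges over rings whose elements lie in the type \<open>'b\<close> of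
  sections of \<open>X\<close>. This is no restriction: a ring \<open>R\<close> whose spectrum is isomorphic to \<open>X\<close> is
  isomorphic to the ring of global sections of \<open>X\<close>, which has elements in \<open>'b\<close>.\<close>

definition affine_scheme :: "('a, 'b) ringed_space \<Rightarrow> bool"
  where "affine_scheme X \<longleftrightarrow>
    (\<exists>R::'b ring. cring R \<and> isomorphic_ringed_spaces X (Spec R))"

definition unit_additive :: "('a, 'b) ringed_space \<Rightarrow> bool"
  where "unit_additive X \<longleftrightarrow>
    (\<exists>R::'b ring. unit_additive_ring R \<and> isomorphic_ringed_spaces X (Spec R))"

definition scheme :: "('a, 'b) ringed_space \<Rightarrow> bool"
  where "scheme X \<longleftrightarrow> locally_ringed_space X \<and>
    (\<forall>x\<in>topspace (points X). \<exists>U. openin (points X) U \<and> x \<in> U \<and>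
       affine_scheme (open_subspace X U))"

definition locally_unit_additive :: "('a, 'b) ringed_space \<Rightarrow> bool"
  where "locally_unit_additive X \<longleftrightarrow>
    (\<exists>\<U>. (\<forall>U\<in>\<U>. openin (points X) U \<and> unit_additive (open_subspace X U)) \<and>
         \<Union>\<U> = topspace (points X))"

end

theory Submission
  imports Defs "HOL-Algebra.Ring_Divisibility"
begin

text \<open>The component \<open>C\<close> of an affine scheme \<open>Spec R\<close> is the basic open set of an idempotent \<open>e\<close>, hence
  the spectrum of the factor \<open>eR\<close>. Units \<open>u\<close>, \<open>v\<close> of \<open>eR\<close> are lifted to the units \<open>u + (1 - e)\<close> and
  \<open>v - (1 - e)\<close> of \<open>R\<close>, with the same sum \<open>w\<close>. If \<open>R\<close> is unit-additive, this shows at once that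
  \<open>eR\<close> is, so that unit-additivity passes to clopen subschemes. If \<open>Spec R\<close> is merely covered by
  unit-additive affine open sets, then on each of them \<open>w\<close> is a unit or nilpotent, that is, it
  vanishes nowhere or everywhere. So the nonvanishing locus of \<open>w\<close> is clopen and, \<open>C\<close> being
  connected, contains \<open>C\<close> or is disjoint from it; accordingly \<open>w\<close> is a unit or nilpotent
  in \<open>eR\<close>.\<close>

section \<open>Primes and radicals\<close>

text \<open>Unit-additivity does not pass to arbitrary open subschemes: over a field, the affine
  line has it and loses it when the origin is removed. This is why clopen sets shape the proof;
  finiteness of the set of components enters by making each component open. A unit-additive open set
  U is known only as isomorphic to the spectrum of some ring A that is unrelated to R, so the two
  rings are compared inside the ring of sections over U. Units of R restrict to units there, but
  unit-additivity speaks of elements of A; hence the map from A to the sections must be shown onto,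
  which is the classical fact that the global sections of an affine scheme come from its ring. Units
  and nilpotent elements are recognized by the primes that contain them, so the algebra rests on
  radicals of ideals.\<close>

lemma (in primeideal) pow_mem_iff:
  assumes "x \<in> carrier R" "0 < n"
  shows "x [^] (n::nat) \<in> I \<longleftrightarrow> x \<in> I"
  using assms(2)
proof (induction n rule: nat_induct_non_zero)
  case (Suc n)
  then show ?case
    using I_prime[of "x [^] n" x] assms(1) by (auto intro: I_l_closed)
qed (use assms(1) in simp)

lemma (in primeideal) one_notin: "\<one> \<notin> I"
  using I_notcarr one_imp_carrier by blast

lemma (in primeideal) mult_mem_iff:
  assumes "x \<in> carrier R" "y \<in> carrier R"
  shows "x \<otimes> y \<in> I \<longleftrightarrow> x \<in> I \<or> y \<in> I"
  using I_prime assms by (auto intro: I_l_closed I_r_closed)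

lemma (in ring) ideal_subset_add:
  assumes "ideal I R" "ideal J R"
  shows "I \<subseteq> I <+>\<^bsub>R\<^esub> J" "J \<subseteq> I <+>\<^bsub>R\<^esub> J"
proof -
  have "I \<union> J \<subseteq> carrier R"
    using ideal.Icarr[OF assms(1)] ideal.Icarr[OF assms(2)] by blast
  then have "I \<union> J \<subseteq> I <+>\<^bsub>R\<^esub> J"
    using genideal_self union_genideal[OF assms] by metis
  then show "I \<subseteq> I <+>\<^bsub>R\<^esub> J" "J \<subseteq> I <+>\<^bsub>R\<^esub> J" by auto
qed

text \<open>Krull's argument: an ideal M that is maximal among those containing I and missing every
  power of f is prime. As f lies outside M, this contradicts \<open>primes\<close>. Nilpotents,
  inverses, partitions of unity and the equality of local fractions are all drawn from this
  statement.\<close>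

lemma (in cring) radical_member:
  assumes I: "ideal I R" and f: "f \<in> carrier R"
    and primes: "\<And>p. primeideal p R \<Longrightarrow> I \<subseteq> p \<Longrightarrow> f \<in> p"
  shows "\<exists>n::nat. f [^] n \<in> I"
proof (rule ccontr)
  assume no: "\<nexists>n::nat. f [^] n \<in> I"
  define \<A> where "\<A> = {J. ideal J R \<and> I \<subseteq> J \<and> (\<forall>n::nat. f [^] n \<notin> J)}"
  have "\<exists>M\<in>\<A>. \<forall>X\<in>\<A>. M \<subseteq> X \<longrightarrow> X = M"
  proof (rule subset_Zorn_nonempty)
    show "\<A> \<noteq> {}" using I no by (auto simp: \<A>_def)
    fix \<C> assume ne: "\<C> \<noteq> {}" and ch: "subset.chain \<A> \<C>"
    then have "subset.chain {I. ideal I R} \<C>"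
      by (auto simp: pred_on.chain_def \<A>_def)
    from chain_Union_is_ideal[OF this] ne have "ideal (\<Union>\<C>) R" by simp
    moreover have "\<C> \<subseteq> \<A>" using ch by (simp add: pred_on.chain_def)
    ultimately show "\<Union>\<C> \<in> \<A>" using ne unfolding \<A>_def by blast
  qed
  then obtain M where M\<A>: "M \<in> \<A>" and maximal: "\<forall>X\<in>\<A>. M \<subseteq> X \<longrightarrow> X = M"
    by blast
  then have M: "ideal M R" "I \<subseteq> M" "\<And>n::nat. f [^] n \<notin> M"
    by (auto simp: \<A>_def)
  have max: "\<exists>n::nat. f [^] n \<in> J" if "ideal J R" "M \<subseteq> J" "J \<noteq> M" for J
    using maximal that M(2) unfolding \<A>_def by blast
  interpret M: ideal M R by (rule M)
  \<comment> \<open>For a outside M, the ideal M + (a) is strictly larger than M and so contains a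
    power of f.\<close>
  have extend: "\<exists>(n::nat). \<exists>m\<in>M. \<exists>r\<in>carrier R. f [^] n = m \<oplus> r \<otimes> a"
    if a: "a \<in> carrier R" "a \<notin> M" for a
  proof -
    have id: "ideal (M <+>\<^bsub>R\<^esub> PIdl a) R"
      by (intro add_ideals M cgenideal_ideal a)
    have "M \<subseteq> M <+>\<^bsub>R\<^esub> PIdl a" "a \<in> M <+>\<^bsub>R\<^esub> PIdl a"
      using ideal_subset_add[OF M(1) cgenideal_ideal[OF a(1)]] cgenideal_self[OF a(1)] by auto
    then obtain n::nat where "f [^] n \<in> M <+>\<^bsub>R\<^esub> PIdl a"
      using max[OF id] a by blast
    then show ?thesis
      unfolding set_add_def' cgenideal_def by blast
  qed
  have "primeideal M R"
  proof (rule primeidealI[OF M(1) is_cring])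
    show "carrier R \<noteq> M" using M(3) f nat_pow_closed by blast
    fix a b assume ab: "a \<in> carrier R" "b \<in> carrier R" "a \<otimes> b \<in> M"
    show "a \<in> M \<or> b \<in> M"
    proof (rule ccontr)
      assume "\<not> (a \<in> M \<or> b \<in> M)"
      then obtain n k :: nat and m r m' r' where
        h: "m \<in> M" "r \<in> carrier R" "f [^] n = m \<oplus> r \<otimes> a"
           "m' \<in> M" "r' \<in> carrier R" "f [^] k = m' \<oplus> r' \<otimes> b"
        using extend ab by meson
      have c: "m \<in> carrier R" "m' \<in> carrier R" using h M.Icarr by auto
      \<comment> \<open>The product of the two powers is expanded so that every term has a factor in
        M or the factor ab, which would put a power of f into M.\<close>
      have "f [^] (n + k) = f [^] n \<otimes> f [^] k"
        using f by (simp add: nat_pow_mult)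
      also have "\<dots> = m \<otimes> (m' \<oplus> r' \<otimes> b) \<oplus> (r \<otimes> a) \<otimes> m' \<oplus> (r \<otimes> r') \<otimes> (a \<otimes> b)"
        unfolding h using c h(2,5) ab(1,2) by algebra
      also have "\<dots> \<in> M"
      proof -
        have "m \<otimes> (m' \<oplus> r' \<otimes> b) \<in> M" "(r \<otimes> a) \<otimes> m' \<in> M" "(r \<otimes> r') \<otimes> (a \<otimes> b) \<in> M"
          using c h ab by (simp_all add: M.I_l_closed M.I_r_closed)
        then show ?thesis by simp
      qed
      finally show False using M(3) by blast
    qed
  qed
  with primes M(2) have "f \<in> M" by blast
  with M(3)[of 1] f show False by simp
qed

text \<open>The case I = (g): if D(f) lies in D(g), then g divides a power of f. For f = 1 this
  inverts g; for an idempotent f = e it inverts an element g of eR inside eR.\<close>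

lemma (in cring) radical_member_principal:
  assumes "g \<in> carrier R" "f \<in> carrier R"
    and primes: "\<And>p. primeideal p R \<Longrightarrow> g \<in> p \<Longrightarrow> f \<in> p"
  shows "\<exists>n::nat. \<exists>c\<in>carrier R. f [^] n = c \<otimes> g"
  using radical_member[OF cgenideal_ideal, of g f] assms cgenideal_self[of g]
  unfolding cgenideal_def by blast

text \<open>With f = 1 this gives the partition of unity behind an idempotent; with f a sum of two
  elements it glues two fractions.\<close>

lemma (in cring) radical_member_two:
  assumes x: "x \<in> carrier R" and y: "y \<in> carrier R" and "f \<in> carrier R"
    and primes: "\<And>p. primeideal p R \<Longrightarrow> x \<in> p \<Longrightarrow> y \<in> p \<Longrightarrow> f \<in> p"
  shows "\<exists>n::nat. \<exists>b\<in>carrier R. \<exists>c\<in>carrier R. f [^] n = b \<otimes> x \<oplus> c \<otimes> y"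
proof -
  have id: "ideal (PIdl x <+>\<^bsub>R\<^esub> PIdl y) R"
    by (intro add_ideals cgenideal_ideal x y)
  have "x \<in> PIdl x <+>\<^bsub>R\<^esub> PIdl y" "y \<in> PIdl x <+>\<^bsub>R\<^esub> PIdl y"
    using ideal_subset_add[OF cgenideal_ideal[OF x] cgenideal_ideal[OF y]]
      cgenideal_self[OF x] cgenideal_self[OF y] by auto
  then obtain n::nat where "f [^] n \<in> PIdl x <+>\<^bsub>R\<^esub> PIdl y"
    using radical_member[OF id] assms by blast
  then show ?thesis unfolding set_add_def' cgenideal_def by blast
qed

lemma (in cring) nilpotent_if_in_all_primes:
  assumes "f \<in> carrier R" "\<And>p. primeideal p R \<Longrightarrow> f \<in> p"
  shows "nilpotent_elem R f"
proof -
  obtain n::nat where "f [^] n = \<zero>"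
    using radical_member[OF zeroideal] assms by blast
  \<comment> \<open>The exponent found may be 0, which happens in the zero ring, while
    \<open>nilpotent_elem\<close> asks for a positive one.\<close>
  then have "f [^] Suc n = \<zero>" using assms(1) by simp
  then show ?thesis using assms(1) unfolding nilpotent_elem_def by blast
qed

lemma (in cring) unit_if_in_no_prime:
  assumes f: "f \<in> carrier R" and no: "\<And>p. primeideal p R \<Longrightarrow> f \<notin> p"
  shows "f \<in> Units R"
proof -
  obtain n::nat and c where "c \<in> carrier R" "\<one> [^] n = c \<otimes> f"
    using radical_member_principal[of f \<one>] f no by blast
  then show ?thesis using f m_comm unfolding Units_def by auto
qed

section \<open>Basic open sets, and idempotents from clopen sets\<close>

lemma topspace_zariski: "topspace (zariski_topology R) = prime_ideals R"
proof -
  have "p \<in> \<Union>{U. zariski_open R U}" if p: "p \<in> prime_ideals R" for p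
  proof -
    interpret primeideal p R using p by (simp add: prime_ideals_def)
    have "p \<in> prime_ideals R - zero_locus R {\<one>\<^bsub>R\<^esub>}" "zariski_open R (prime_ideals R - zero_locus R {\<one>\<^bsub>R\<^esub>})"
      using p one_notin unfolding zariski_open_def zero_locus_def by auto
    then show ?thesis by blast
  qed
  then show ?thesis
    unfolding topspace_def openin_zariski_topology by (auto simp: zariski_open_def)
qed

definition basic_open :: "('r, 'm) ring_scheme \<Rightarrow> 'r \<Rightarrow> 'r set set"
  where "basic_open R f = {p. primeideal p R \<and> f \<notin> p}"

lemma zariski_open_basic: "f \<in> carrier R \<Longrightarrow> zariski_open R (basic_open R f)"
  unfolding zariski_open_def basic_open_def zero_locus_def prime_ideals_def
  by (intro exI[of _ "{f}"]) auto

lemma zariski_open_contains_basic: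
  assumes "zariski_open R V" "p \<in> V"
  obtains h where "h \<in> carrier R" "p \<in> basic_open R h" "basic_open R h \<subseteq> V"
proof -
  obtain E where E: "E \<subseteq> carrier R" "V = prime_ideals R - zero_locus R E"
    using assms by (auto simp: zariski_open_def)
  with assms obtain h where "h \<in> E" "h \<notin> p" "primeideal p R"
    by (auto simp: zero_locus_def prime_ideals_def)
  with E show ?thesis
    by (intro that[of h]) (auto simp: basic_open_def zero_locus_def prime_ideals_def)
qed

text \<open>No prime contains both E and F, so 1 = a + b with a vanishing off D and b vanishing on
  D. The product ab is merely nilpotent; passing to powers makes it zero, and a new partition of
  unity built from the powers splits 1 into orthogonal idempotents.\<close>

lemma (in cring) clopen_idempotent:
  assumes D: "zariski_open R D" and D': "zariski_open R (prime_ideals R - D)"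
  obtains e where "e \<in> carrier R" "e \<otimes> e = e" "D = basic_open R e"
proof -
  obtain E F where E: "E \<subseteq> carrier R" "D = prime_ideals R - zero_locus R E"
    and F: "F \<subseteq> carrier R" "prime_ideals R - D = prime_ideals R - zero_locus R F"
    using D D' by (auto simp: zariski_open_def)
  have inD: "p \<in> D \<longleftrightarrow> \<not> E \<subseteq> p" "p \<in> D \<longleftrightarrow> F \<subseteq> p" if "primeideal p R" for p
    using that E(2) F(2) by (auto simp: prime_ideals_def zero_locus_def set_eq_iff)
  have idE: "ideal (Idl E) R" and idF: "ideal (Idl F) R"
    using E F genideal_ideal by auto
  have id: "ideal (Idl E <+>\<^bsub>R\<^esub> Idl F) R"
    by (intro add_ideals idE idF)
  have sub: "Idl E \<subseteq> Idl E <+>\<^bsub>R\<^esub> Idl F" "Idl F \<subseteq> Idl E <+>\<^bsub>R\<^esub> Idl F"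
    using ideal_subset_add[OF idE idF] by auto
  have no: "\<not> (Idl E <+>\<^bsub>R\<^esub> Idl F \<subseteq> p)" if "primeideal p R" for p
    using inD[OF that] sub genideal_self[OF E(1)] genideal_self[OF F(1)] by blast
  obtain n::nat where "\<one> [^] n \<in> Idl E <+>\<^bsub>R\<^esub> Idl F"
    using radical_member[OF id, of \<one>] no by auto
  then obtain a b where ab: "a \<in> Idl E" "b \<in> Idl F" "\<one> = a \<oplus> b"
    unfolding set_add_def' by auto
  have car: "a \<in> carrier R" "b \<in> carrier R"
    using ab ideal.Icarr[OF idE] ideal.Icarr[OF idF] by auto
  have pa: "a \<in> p" if "primeideal p R" "p \<notin> D" for p
    using that inD[OF that(1)] ab(1) genideal_minimal[of p E] primeideal.axioms(1) by blast
  have pb: "b \<in> p" if "primeideal p R" "p \<in> D" for p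
    using that inD[OF that(1)] ab(2) genideal_minimal[of p F] primeideal.axioms(1) by blast
  have "nilpotent_elem R (a \<otimes> b)"
  proof (rule nilpotent_if_in_all_primes)
    show "a \<otimes> b \<in> carrier R" using car by simp
    show "a \<otimes> b \<in> p" if "primeideal p R" for p
      using pa[OF that] pb[OF that] car primeideal.mult_mem_iff[OF that] by auto
  qed
  then obtain n::nat where n: "0 < n" "(a \<otimes> b) [^] n = \<zero>"
    by (auto simp: nilpotent_elem_def)
  \<comment> \<open>These powers vanish at the same primes as a and b, and their product is exactly
    zero.\<close>
  define x y where "x = a [^] n" and "y = b [^] n"
  have xy: "x \<in> carrier R" "y \<in> carrier R" "x \<otimes> y = \<zero>"
    using car n by (auto simp: x_def y_def nat_pow_distrib)
  have xp: "x \<in> p \<longleftrightarrow> a \<in> p" "y \<in> p \<longleftrightarrow> b \<in> p" if "primeideal p R" for p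
    using that car n(1) by (auto simp: x_def y_def primeideal.pow_mem_iff)
  have "\<one> \<in> p" if "primeideal p R" "x \<in> p" "y \<in> p" for p
    using xp[OF that(1)] that ab(3) additive_subgroup.a_closed[of p R a b]
      ideal.axioms(1)[OF primeideal.axioms(1)] by auto
  from radical_member_two[OF xy(1,2) one_closed this]
  obtain c d where cd: "c \<in> carrier R" "d \<in> carrier R" "\<one> = c \<otimes> x \<oplus> d \<otimes> y"
    by auto
  \<comment> \<open>The summands cx and dy of 1 are orthogonal because xy = 0, which makes each of
    them idempotent.\<close>
  define e where "e = c \<otimes> x"
  have "e \<otimes> (d \<otimes> y) = (c \<otimes> d) \<otimes> (x \<otimes> y)"
    unfolding e_def using cd xy(1,2) by algebra
  then have 0: "e \<otimes> (d \<otimes> y) = \<zero>" using xy cd by simp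
  have e: "e \<in> carrier R" using cd xy by (simp add: e_def)
  have "e \<otimes> e = e \<otimes> e \<oplus> e \<otimes> (d \<otimes> y)" using 0 e by simp
  also have "\<dots> = e \<otimes> (e \<oplus> d \<otimes> y)" using e cd xy by algebra
  also have "\<dots> = e" using cd(3) e unfolding e_def by (metis r_one)
  finally have ee: "e \<otimes> e = e" .
  have "p \<in> D \<longleftrightarrow> e \<notin> p" if p: "primeideal p R" for p
  proof -
    interpret p: primeideal p R by (rule p)
    show ?thesis
    proof
      assume "p \<in> D"
      then have "d \<otimes> y \<in> p" using pb p xp cd(2) p.I_l_closed by blast
      then show "e \<notin> p" using cd(3) p.one_notin p.a_closed unfolding e_def by metis
    next
      assume "e \<notin> p"
      then show "p \<in> D" using pa p xp cd(1) p.I_l_closed e_def by blast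
    qed
  qed
  then have "D = basic_open R e"
    using E(2) by (auto simp: basic_open_def prime_ideals_def)
  with e ee show ?thesis by (rule that)
qed

section \<open>Localization and the structure sheaf\<close>

locale mult_closed = cring +
  fixes S
  assumes S_subset: "S \<subseteq> carrier R"
    and one_in_S: "\<one> \<in> S"
    and mult_in_S: "\<lbrakk>s \<in> S; t \<in> S\<rbrakk> \<Longrightarrow> s \<otimes> t \<in> S"
begin

lemma S_carrier: "s \<in> S \<Longrightarrow> s \<in> carrier R"
  using S_subset by blast

text \<open>Without the difference, most proofs about fractions become equations between products
  that \<open>m_ac\<close> can rearrange.\<close>

lemma loc_rel_iff:
  "((a, s), (b, t)) \<in> loc_rel R S \<longleftrightarrow>
     a \<in> carrier R \<and> s \<in> S \<and> b \<in> carrier R \<and> t \<in> S \<and>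
     (\<exists>u\<in>S. u \<otimes> (t \<otimes> a) = u \<otimes> (s \<otimes> b))"
proof -
  have "u \<otimes> (t \<otimes> a \<ominus> s \<otimes> b) = \<zero> \<longleftrightarrow> u \<otimes> (t \<otimes> a) = u \<otimes> (s \<otimes> b)"
    if "a \<in> carrier R" "s \<in> S" "b \<in> carrier R" "t \<in> S" "u \<in> S" for u
  proof -
    have "u \<otimes> (t \<otimes> a \<ominus> s \<otimes> b) = u \<otimes> (t \<otimes> a) \<ominus> u \<otimes> (s \<otimes> b)"
      using that S_carrier by algebra
    then show ?thesis using that S_carrier by (simp add: r_right_minus_eq)
  qed
  then show ?thesis unfolding loc_rel_def by auto
qed

lemma equiv_loc_rel: "equiv (carrier R \<times> S) (loc_rel R S)"
proof (rule equivI)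
  show "loc_rel R S \<subseteq> (carrier R \<times> S) \<times> (carrier R \<times> S)"
    unfolding loc_rel_def by auto
  show "refl_on (carrier R \<times> S) (loc_rel R S)"
    by (rule refl_onI) (use one_in_S in \<open>auto simp: loc_rel_iff\<close>)
  show "sym (loc_rel R S)"
    by (rule symI) (force simp: loc_rel_iff)
  show "trans (loc_rel R S)"
  proof (rule transI, clarify)
    fix a s b t c r
    assume "((a, s), (b, t)) \<in> loc_rel R S" "((b, t), (c, r)) \<in> loc_rel R S"
    then obtain u v where h: "a \<in> carrier R" "s \<in> S" "b \<in> carrier R" "t \<in> S" "c \<in> carrier R" "r \<in> S"
      "u \<in> S" "v \<in> S" and eq: "u \<otimes> (t \<otimes> a) = u \<otimes> (s \<otimes> b)" "v \<otimes> (r \<otimes> b) = v \<otimes> (t \<otimes> c)"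
      unfolding loc_rel_iff by blast
    note c = h S_carrier[OF h(2)] S_carrier[OF h(4)] S_carrier[OF h(6)] S_carrier[OF h(7)] S_carrier[OF h(8)]
    \<comment> \<open>The middle denominator t enters the witness because neither equation can be
      divided by it.\<close>
    have "(u \<otimes> v \<otimes> t) \<otimes> (r \<otimes> a) = (v \<otimes> r) \<otimes> (u \<otimes> (t \<otimes> a))" using c by (simp add: m_ac)
    also have "\<dots> = (v \<otimes> r) \<otimes> (u \<otimes> (s \<otimes> b))" by (simp only: eq)
    also have "\<dots> = (u \<otimes> s) \<otimes> (v \<otimes> (r \<otimes> b))" using c by (simp add: m_ac)
    also have "\<dots> = (u \<otimes> s) \<otimes> (v \<otimes> (t \<otimes> c))" by (simp only: eq)
    also have "\<dots> = (u \<otimes> v \<otimes> t) \<otimes> (s \<otimes> c)" using c by (simp add: m_ac)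
    finally show "((a, s), (c, r)) \<in> loc_rel R S"
      using h mult_in_S unfolding loc_rel_iff by blast
  qed
qed

lemma fraction_eq_iff:
  assumes "a \<in> carrier R" "s \<in> S" "b \<in> carrier R" "t \<in> S"
  shows "fraction R S a s = fraction R S b t \<longleftrightarrow> (\<exists>u\<in>S. u \<otimes> (t \<otimes> a) = u \<otimes> (s \<otimes> b))"
  unfolding fraction_def
  using eq_equiv_class_iff[OF equiv_loc_rel, of "(a, s)" "(b, t)"] assms by (simp add: loc_rel_iff)

lemma fraction_eqI:
  assumes "a \<in> carrier R" "s \<in> S" "b \<in> carrier R" "t \<in> S" "t \<otimes> a = s \<otimes> b"
  shows "fraction R S a s = fraction R S b t"
  using assms one_in_S unfolding fraction_eq_iff[OF assms(1-4)] by metis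

lemma mem_fraction_iff:
  assumes "a \<in> carrier R" "s \<in> S"
  shows "(b, t) \<in> fraction R S a s \<longleftrightarrow>
    b \<in> carrier R \<and> t \<in> S \<and> (\<exists>u\<in>S. u \<otimes> (t \<otimes> a) = u \<otimes> (s \<otimes> b))"
  using assms unfolding fraction_def by (auto simp: loc_rel_iff)

lemma self_mem_fraction:
  "\<lbrakk>a \<in> carrier R; s \<in> S\<rbrakk> \<Longrightarrow> (a, s) \<in> fraction R S a s"
  using one_in_S by (auto simp: mem_fraction_iff)

lemma carrier_localization:
  "carrier (localization R S) = {fraction R S a s | a s. a \<in> carrier R \<and> s \<in> S}"
  unfolding localization_def fraction_def quotient_def by auto

lemma fraction_closed:
  "\<lbrakk>a \<in> carrier R; s \<in> S\<rbrakk> \<Longrightarrow> fraction R S a s \<in> carrier (localization R S)"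
  unfolding carrier_localization by blast

end

text \<open>The operations of \<open>localization\<close> are unions over representatives. Once all
  representatives yield the same class, nonemptiness of both arguments collapses the union to that
  class.\<close>

lemma UN_pair_const:
  assumes "x \<in> X" "y \<in> Y"
    and "\<And>a s b t. \<lbrakk>(a, s) \<in> X; (b, t) \<in> Y\<rbrakk> \<Longrightarrow> F a s b t = G"
  shows "(\<Union>(a, s)\<in>X. \<Union>(b, t)\<in>Y. F a s b t) = G"
proof -
  have inner: "(\<Union>(b, t)\<in>Y. F a s b t) = G" if "(a, s) \<in> X" for a s
  proof -
    have "(\<Union>(b, t)\<in>Y. F a s b t) = (\<Union>y\<in>Y. G)"
      by (rule SUP_cong) (use assms(3)[OF that] in auto)
    then show ?thesis using assms(2) by auto
  qed
  have "(\<Union>(a, s)\<in>X. \<Union>(b, t)\<in>Y. F a s b t) = (\<Union>x\<in>X. G)"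
  proof (rule SUP_cong[OF refl])
    fix x assume "x \<in> X"
    then show "(case x of (a, s) \<Rightarrow> \<Union>(b, t)\<in>Y. F a s b t) = G"
      using inner[of "fst x" "snd x"] by (simp only: prod.case_eq_if prod.collapse)
  qed
  then show ?thesis using assms(1) by auto
qed

context mult_closed
begin

lemma mult_fraction:
  assumes a: "a \<in> carrier R" "s \<in> S" and b: "b \<in> carrier R" "t \<in> S"
  shows "fraction R S a s \<otimes>\<^bsub>localization R S\<^esub> fraction R S b t = fraction R S (a \<otimes> b) (s \<otimes> t)"
proof -
  have "fraction R S (a' \<otimes> b') (s' \<otimes> t') = fraction R S (a \<otimes> b) (s \<otimes> t)"
    if a': "(a', s') \<in> fraction R S a s" and b': "(b', t') \<in> fraction R S b t" for a' s' b' t'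
  proof -
    obtain u v where u: "u \<in> S" "u \<otimes> (s' \<otimes> a) = u \<otimes> (s \<otimes> a')" "a' \<in> carrier R" "s' \<in> S"
      and v: "v \<in> S" "v \<otimes> (t' \<otimes> b) = v \<otimes> (t \<otimes> b')" "b' \<in> carrier R" "t' \<in> S"
      using a' b' a b by (auto simp: mem_fraction_iff)
    note c = a b u(1,3,4) v(1,3,4)
    have "(u \<otimes> v) \<otimes> ((s \<otimes> t) \<otimes> (a' \<otimes> b')) = (u \<otimes> (s \<otimes> a')) \<otimes> (v \<otimes> (t \<otimes> b'))"
      using S_carrier c by (simp add: m_ac)
    also have "\<dots> = (u \<otimes> (s' \<otimes> a)) \<otimes> (v \<otimes> (t' \<otimes> b))" using u v by simp
    also have "\<dots> = (u \<otimes> v) \<otimes> ((s' \<otimes> t') \<otimes> (a \<otimes> b))"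
      using S_carrier c by (simp add: m_ac)
    finally show ?thesis
      using c mult_in_S by (subst fraction_eq_iff) auto
  qed
  then show ?thesis
    unfolding localization_def monoid.simps ring.simps
    by (intro UN_pair_const[OF self_mem_fraction[OF a] self_mem_fraction[OF b]])
qed

lemma add_fraction:
  assumes a: "a \<in> carrier R" "s \<in> S" and b: "b \<in> carrier R" "t \<in> S"
  shows "fraction R S a s \<oplus>\<^bsub>localization R S\<^esub> fraction R S b t
    = fraction R S (t \<otimes> a \<oplus> s \<otimes> b) (s \<otimes> t)"
proof -
  have "fraction R S (t' \<otimes> a' \<oplus> s' \<otimes> b') (s' \<otimes> t') = fraction R S (t \<otimes> a \<oplus> s \<otimes> b) (s \<otimes> t)"
    if a': "(a', s') \<in> fraction R S a s" and b': "(b', t') \<in> fraction R S b t" for a' s' b' t'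
  proof -
    obtain u v where u: "u \<in> S" "u \<otimes> (s' \<otimes> a) = u \<otimes> (s \<otimes> a')" "a' \<in> carrier R" "s' \<in> S"
      and v: "v \<in> S" "v \<otimes> (t' \<otimes> b) = v \<otimes> (t \<otimes> b')" "b' \<in> carrier R" "t' \<in> S"
      using a' b' a b by (auto simp: mem_fraction_iff)
    note c = a b u(1,3,4) v(1,3,4)
    have d: "a \<in> carrier R" "b \<in> carrier R" "a' \<in> carrier R" "b' \<in> carrier R" "s \<in> carrier R"
       "t \<in> carrier R" "s' \<in> carrier R" "t' \<in> carrier R" "u \<in> carrier R" "v \<in> carrier R"
      using c S_carrier by auto
    have "(u \<otimes> v) \<otimes> ((s \<otimes> t) \<otimes> (t' \<otimes> a' \<oplus> s' \<otimes> b'))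
        = (v \<otimes> t \<otimes> t') \<otimes> (u \<otimes> (s \<otimes> a')) \<oplus> (u \<otimes> s \<otimes> s') \<otimes> (v \<otimes> (t \<otimes> b'))"
      using d by algebra
    also have "\<dots> = (v \<otimes> t \<otimes> t') \<otimes> (u \<otimes> (s' \<otimes> a)) \<oplus> (u \<otimes> s \<otimes> s') \<otimes> (v \<otimes> (t' \<otimes> b))"
      using u v by simp
    also have "\<dots> = (u \<otimes> v) \<otimes> ((s' \<otimes> t') \<otimes> (t \<otimes> a \<oplus> s \<otimes> b))"
      using d by algebra
    finally show ?thesis
      using c d mult_in_S by (subst fraction_eq_iff) auto
  qed
  then show ?thesis
    unfolding localization_def monoid.simps ring.simps
    by (intro UN_pair_const[OF self_mem_fraction[OF a] self_mem_fraction[OF b]])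
qed

end

lemma one_localization: "\<one>\<^bsub>localization R S\<^esub> = fraction R S \<one>\<^bsub>R\<^esub> \<one>\<^bsub>R\<^esub>"
  and zero_localization: "\<zero>\<^bsub>localization R S\<^esub> = fraction R S \<zero>\<^bsub>R\<^esub> \<one>\<^bsub>R\<^esub>"
  by (simp_all add: localization_def)

text \<open>Every prime thus brings the calculus of fractions for its own complement, under the
  prefix \<open>loc\<close>; primes of two rings can then be handled side by side.\<close>

sublocale primeideal \<subseteq> loc: mult_closed R "carrier R - I"
  by unfold_locales (use one_notin mult_mem_iff in auto)

section \<open>Constant sections and the ring of global sections\<close>

lemma zariski_openD:
  assumes "zariski_open R V" "p \<in> V"
  shows "primeideal p R"
  using assms by (auto simp: zariski_open_def prime_ideals_def)

text \<open>The canonical map from R to the sections over V. It will turn out to be onto when V is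
  the whole spectrum.\<close>

definition const_section :: "('r, 'm) ring_scheme \<Rightarrow> 'r set set \<Rightarrow> 'r \<Rightarrow> 'r set \<Rightarrow> ('r \<times> 'r) set"
  where "const_section R V a = (\<lambda>p\<in>V. fraction_at R p a \<one>\<^bsub>R\<^esub>)"

lemma regular_functionsE:
  assumes "s \<in> regular_functions R U" "p \<in> U"
  obtains V a g where "zariski_open R V" "p \<in> V" "V \<subseteq> U" "a \<in> carrier R" "g \<in> carrier R"
    "\<And>q. q \<in> V \<Longrightarrow> g \<notin> q" "\<And>q. q \<in> V \<Longrightarrow> s q = fraction_at R q a g"
proof -
  have "\<forall>p\<in>U. \<exists>V. zariski_open R V \<and> p \<in> V \<and> V \<subseteq> U \<and>
      (\<exists>a\<in>carrier R. \<exists>g\<in>carrier R. \<forall>q\<in>V. g \<notin> q \<and> s q = fraction_at R q a g)"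
    using assms(1) by (simp add: regular_functions_def)
  from bspec[OF this assms(2)] obtain V where V: "zariski_open R V" "p \<in> V" "V \<subseteq> U"
    and ex: "\<exists>a\<in>carrier R. \<exists>g\<in>carrier R. \<forall>q\<in>V. g \<notin> q \<and> s q = fraction_at R q a g"
    by blast
  from ex obtain a g where ag: "a \<in> carrier R" "g \<in> carrier R"
    and "\<forall>q\<in>V. g \<notin> q \<and> s q = fraction_at R q a g"
    by blast
  then have "\<And>q. q \<in> V \<Longrightarrow> g \<notin> q" "\<And>q. q \<in> V \<Longrightarrow> s q = fraction_at R q a g"
    by blast+
  with V ag show ?thesis by (rule that)
qed

lemma (in cring) const_section_hom:
  assumes V: "zariski_open R V"
  shows "const_section R V \<in> ring_hom R (structure_ring R V)"
proof (rule ring_hom_memI)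
  fix a b assume a: "a \<in> carrier R" and b: "b \<in> carrier R"
  have fr: "fraction_at R p a \<one> \<in> carrier (loc_at R p)"
    "fraction_at R p a \<one> \<otimes>\<^bsub>loc_at R p\<^esub> fraction_at R p b \<one> = fraction_at R p (a \<otimes> b) \<one>"
    "fraction_at R p a \<one> \<oplus>\<^bsub>loc_at R p\<^esub> fraction_at R p b \<one> = fraction_at R p (a \<oplus> b) \<one>"
    if "p \<in> V" for p
  proof -
    interpret p: primeideal p R using V that by (rule zariski_openD)
    show "fraction_at R p a \<one> \<in> carrier (loc_at R p)"
      "fraction_at R p a \<one> \<otimes>\<^bsub>loc_at R p\<^esub> fraction_at R p b \<one> = fraction_at R p (a \<otimes> b) \<one>"
      "fraction_at R p a \<one> \<oplus>\<^bsub>loc_at R p\<^esub> fraction_at R p b \<one> = fraction_at R p (a \<oplus> b) \<one>"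
      using a b p.loc.one_in_S by (simp_all add: p.loc.fraction_closed p.loc.mult_fraction p.loc.add_fraction)
  qed
  have "\<forall>q\<in>V. \<one> \<notin> q \<and> const_section R V a q = fraction_at R q a \<one>"
    using primeideal.one_notin[OF zariski_openD[OF V]] by (simp add: const_section_def)
  then have "\<exists>W. zariski_open R W \<and> p \<in> W \<and> W \<subseteq> V \<and>
      (\<exists>c\<in>carrier R. \<exists>g\<in>carrier R. \<forall>q\<in>W. g \<notin> q \<and> const_section R V a q = fraction_at R q c g)"
    if "p \<in> V" for p
    using that V a one_closed by blast
  moreover have "const_section R V a \<in> (\<Pi>\<^sub>E p\<in>V. carrier (loc_at R p))"
    using fr(1) by (simp add: const_section_def)
  ultimately show "const_section R V a \<in> carrier (structure_ring R V)"
    unfolding structure_ring_def regular_functions_def by simp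
  show "const_section R V (a \<otimes> b) = const_section R V a \<otimes>\<^bsub>structure_ring R V\<^esub> const_section R V b"
    "const_section R V (a \<oplus> b) = const_section R V a \<oplus>\<^bsub>structure_ring R V\<^esub> const_section R V b"
    using fr by (auto simp: structure_ring_def const_section_def fun_eq_iff)
qed (auto simp: structure_ring_def const_section_def one_localization)

text \<open>Writing the inverse at p as a/g gives u(aw) = ug for some u outside p. If w were in p,
  the left side would be in p, while the right side is a product of elements outside p.\<close>

lemma (in cring) const_section_unit_notin:
  assumes V: "zariski_open R V" and w: "w \<in> carrier R" and t: "t \<in> carrier (structure_ring R V)"
    and eq: "t \<otimes>\<^bsub>structure_ring R V\<^esub> const_section R V w = \<one>\<^bsub>structure_ring R V\<^esub>"
    and p: "p \<in> V"
  shows "w \<notin> p"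
proof
  assume wp: "w \<in> p"
  interpret p: primeideal p R using V p by (rule zariski_openD)
  have "t \<in> regular_functions R V" using t by (simp add: structure_ring_def)
  then obtain a g where ag: "a \<in> carrier R" "g \<in> carrier R" "g \<notin> p" "t p = fraction_at R p a g"
    using p by (metis regular_functionsE)
  have "t p \<otimes>\<^bsub>loc_at R p\<^esub> fraction_at R p w \<one> = fraction_at R p \<one> \<one>"
    using fun_cong[OF eq, of p] p by (simp add: structure_ring_def const_section_def one_localization)
  then have "fraction_at R p (a \<otimes> w) g = fraction_at R p \<one> \<one>"
    using ag w p.loc.one_in_S by (simp add: p.loc.mult_fraction)
  then obtain u where u: "u \<in> carrier R - p" "u \<otimes> (\<one> \<otimes> (a \<otimes> w)) = u \<otimes> (g \<otimes> \<one>)"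
    using ag w p.loc.one_in_S by (auto simp: p.loc.fraction_eq_iff)
  have "u \<otimes> (a \<otimes> w) \<in> p" using u(1) ag w wp by (simp add: p.I_l_closed)
  then have "u \<otimes> g \<in> p" using u ag w by simp
  then show False using u ag p.mult_mem_iff[of u g] by simp
qed

text \<open>If w/1 = 0 at p, then some u outside p satisfies uw = 0, and primality does the
  rest.\<close>

lemma (in cring) const_section_zero_in:
  assumes V: "zariski_open R V" and w: "w \<in> carrier R"
    and eq: "const_section R V w = \<zero>\<^bsub>structure_ring R V\<^esub>"
    and p: "p \<in> V"
  shows "w \<in> p"
proof -
  interpret p: primeideal p R using V p by (rule zariski_openD)
  have "fraction_at R p w \<one> = fraction_at R p \<zero> \<one>"
    using fun_cong[OF eq, of p] p by (simp add: structure_ring_def const_section_def zero_localization)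
  then obtain u where u: "u \<in> carrier R - p" "u \<otimes> (\<one> \<otimes> w) = u \<otimes> (\<one> \<otimes> \<zero>)"
    using w p.loc.one_in_S by (auto simp: p.loc.fraction_eq_iff)
  then have "u \<otimes> w \<in> p" using w by simp
  then show "w \<in> p" using u w p.mult_mem_iff[of u w] by simp
qed

text \<open>Equality at q gives an element outside q that kills d = ta - sb. So a prime containing
  the annihilator of d is not in D(f), that is, it contains f; hence a power of f kills d.\<close>

lemma (in cring) fraction_eq_on_basic_open:
  assumes f: "f \<in> carrier R" and car: "a \<in> carrier R" "s \<in> carrier R" "b \<in> carrier R" "t \<in> carrier R"
    and nz: "\<And>q. q \<in> basic_open R f \<Longrightarrow> s \<notin> q \<and> t \<notin> q"
    and eq: "\<And>q. q \<in> basic_open R f \<Longrightarrow> fraction_at R q a s = fraction_at R q b t"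
  shows "\<exists>N::nat. f [^] N \<otimes> (t \<otimes> a) = f [^] N \<otimes> (s \<otimes> b)"
proof -
  define d where "d = t \<otimes> a \<ominus> s \<otimes> b"
  have d: "d \<in> carrier R" using car by (simp add: d_def)
  \<comment> \<open>Applied to the zero ideal, \<open>helper_max_prime\<close> says that the
    annihilator of d is an ideal.\<close>
  have id: "ideal {x \<in> carrier R. d \<otimes> x \<in> {\<zero>}} R"
    by (rule ideal.helper_max_prime[OF zeroideal is_cring d])
  have dx: "d \<otimes> x = \<zero> \<longleftrightarrow> x \<otimes> (t \<otimes> a) = x \<otimes> (s \<otimes> b)" if x: "x \<in> carrier R" for x
  proof -
    have "d \<otimes> x = x \<otimes> (t \<otimes> a) \<ominus> x \<otimes> (s \<otimes> b)"
      unfolding d_def using car x by algebra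
    then show ?thesis using car x by (simp add: r_right_minus_eq)
  qed
  have "f \<in> q" if q: "primeideal q R" and sub: "{x \<in> carrier R. d \<otimes> x \<in> {\<zero>}} \<subseteq> q" for q
  proof (rule ccontr)
    assume "f \<notin> q"
    then have D: "q \<in> basic_open R f" using q by (simp add: basic_open_def)
    interpret q: primeideal q R by (rule q)
    obtain u where "u \<in> carrier R - q" "u \<otimes> (t \<otimes> a) = u \<otimes> (s \<otimes> b)"
      using eq[OF D] nz[OF D] car by (auto simp: q.loc.fraction_eq_iff)
    then show False using sub dx by auto
  qed
  from radical_member[OF id f this] show ?thesis using dx f by auto
qed

text \<open>The exponent 0 is included here, since 1 is never in a prime; this suits denominators
  whose exponent is unknown.\<close>

lemma (in primeideal) pow_notin:
  assumes "x \<in> carrier R" "x \<notin> I"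
  shows "x [^] (n::nat) \<notin> I"
  using assms one_notin pow_mem_iff[of x n] by (cases "n = 0") auto

text \<open>The functions \<open>f\<close> on whose basic open set a given section is a fraction \<open>a/f\<^sup>n\<close> form an
  ideal; so no finite subcover has to be chosen in the gluing argument.\<close>

lemma (in cring) global_section_const:
  assumes s: "s \<in> regular_functions R (prime_ideals R)"
  shows "\<exists>a\<in>carrier R. s = const_section R (prime_ideals R) a"
proof -
  define P where "P f n a \<longleftrightarrow> a \<in> carrier R \<and> (\<forall>q\<in>basic_open R f. s q = fraction_at R q a (f [^] n))"
    for f a and n :: nat
  define K where "K = {f \<in> carrier R. \<exists>n a. P f n a}"
  have K_mult: "c \<otimes> f \<in> K" if f: "f \<in> K" and c: "c \<in> carrier R" for c f
  proof -
    obtain n a where na: "P f n a" "f \<in> carrier R" using f by (auto simp: K_def)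
    \<comment> \<open>D(cf) lies in D(f), and expanding by c^n turns the denominator f^n into
      (cf)^n.\<close>
    have "s q = fraction_at R q (c [^] n \<otimes> a) ((c \<otimes> f) [^] n)" if q: "q \<in> basic_open R (c \<otimes> f)" for q
    proof -
      interpret q: primeideal q R using q by (simp add: basic_open_def)
      have nq: "c \<otimes> f \<notin> q" "f \<notin> q" using q na(2) c by (auto simp: basic_open_def q.mult_mem_iff)
      have "s q = fraction_at R q a (f [^] n)"
        using na(1) nq q.primeideal_axioms by (auto simp: P_def basic_open_def)
      also have "\<dots> = fraction_at R q (c [^] n \<otimes> a) ((c \<otimes> f) [^] n)"
        using na c q.pow_notin[OF na(2) nq(2), of n] q.pow_notin[OF _ nq(1), of n]
        by (intro q.loc.fraction_eqI) (auto simp: P_def nat_pow_distrib m_ac)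
      finally show ?thesis .
    qed
    then have "P (c \<otimes> f) n (c [^] n \<otimes> a)" using na c by (simp add: P_def)
    then show ?thesis using c na(2) by (auto simp: K_def)
  qed
  have K_add: "f \<oplus> g \<in> K" if fK: "f \<in> K" and gK: "g \<in> K" for f g
  proof -
    obtain n a m b where na: "P f n a" and mb: "P g m b" using fK gK by (auto simp: K_def)
    have car: "f \<in> carrier R" "g \<in> carrier R" "a \<in> carrier R" "b \<in> carrier R"
      using fK gK na mb by (auto simp: K_def P_def)
    have fg: "f \<notin> q \<and> g \<notin> q \<and> primeideal q R" if "q \<in> basic_open R (f \<otimes> g)" for q
      using that primeideal.mult_mem_iff[OF _ car(1,2)] by (auto simp: basic_open_def)
    \<comment> \<open>On D(fg) both fractions represent s, so the cross products agree up to a power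
      of fg.\<close>
    have "\<exists>N::nat. (f \<otimes> g) [^] N \<otimes> (g [^] m \<otimes> a) = (f \<otimes> g) [^] N \<otimes> (f [^] n \<otimes> b)"
    proof (rule fraction_eq_on_basic_open)
      fix q assume q: "q \<in> basic_open R (f \<otimes> g)"
      show "f [^] n \<notin> q \<and> g [^] m \<notin> q" using fg[OF q] car primeideal.pow_notin[of q R] by simp
      show "fraction_at R q a (f [^] n) = fraction_at R q b (g [^] m)"
        using fg[OF q] na mb by (auto simp: P_def basic_open_def)
    qed (use car in auto)
    then obtain N :: nat where
      N: "(f \<otimes> g) [^] N \<otimes> (g [^] m \<otimes> a) = (f \<otimes> g) [^] N \<otimes> (f [^] n \<otimes> b)" ..
    \<comment> \<open>Fresh names make the powers atoms for \<open>algebra\<close>.\<close>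
    define F G where "F = f [^] N" and "G = g [^] N"
    define x y where "x = f [^] n" and "y = g [^] m"
    have car2: "F \<in> carrier R" "G \<in> carrier R" "x \<in> carrier R" "y \<in> carrier R"
      using car by (simp_all add: F_def G_def x_def y_def)
    have N: "F \<otimes> G \<otimes> (y \<otimes> a) = F \<otimes> G \<otimes> (x \<otimes> b)"
      using N car by (simp add: F_def G_def x_def y_def nat_pow_distrib)
    \<comment> \<open>Fx and Gy are powers of f and g, so a prime containing both contains f and g
      and therefore f + g.\<close>
    have "\<exists>k::nat. \<exists>c\<in>carrier R. \<exists>d\<in>carrier R. (f \<oplus> g) [^] k = c \<otimes> (F \<otimes> x) \<oplus> d \<otimes> (G \<otimes> y)"
    proof (rule radical_member_two)
      fix q assume q: "primeideal q R" "F \<otimes> x \<in> q" "G \<otimes> y \<in> q"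
      interpret q: primeideal q R by (rule q)
      have "f \<in> q" "g \<in> q" using q(2,3) q.mult_mem_iff q.pow_notin car car2
        unfolding F_def G_def x_def y_def by blast+
      then show "f \<oplus> g \<in> q" by simp
    qed (use car car2 in auto)
    then obtain k :: nat and c d where cd: "c \<in> carrier R" "d \<in> carrier R"
      and k: "(f \<oplus> g) [^] k = c \<otimes> (F \<otimes> x) \<oplus> d \<otimes> (G \<otimes> y)" by blast
    \<comment> \<open>The numerator glued from Fa/(Fx) and Gb/(Gy) with the coefficients of (f +
      g)^k = c(Fx) + d(Gy).\<close>
    define h where "h = c \<otimes> (F \<otimes> a) \<oplus> d \<otimes> (G \<otimes> b)"
    have h: "h \<in> carrier R" using car car2 cd by (simp add: h_def)
    have "s q = fraction_at R q h ((f \<oplus> g) [^] k)" if q: "q \<in> basic_open R (f \<oplus> g)" for q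
    proof -
      interpret q: primeideal q R using q by (simp add: basic_open_def)
      have nq: "(f \<oplus> g) [^] k \<notin> q" using q car q.pow_notin by (auto simp: basic_open_def)
      \<comment> \<open>Where f + g does not vanish, f or g does not vanish, so one of the two given
        fractions is available.\<close>
      consider "f \<notin> q" | "g \<notin> q" using q q.a_closed by (auto simp: basic_open_def)
      then show ?thesis
      proof cases
        case 1
        then have xF: "x \<notin> q" "F \<notin> q" using car q.pow_notin by (auto simp: x_def F_def)
        have "F \<otimes> ((f \<oplus> g) [^] k \<otimes> a) = (c \<otimes> F \<otimes> x) \<otimes> (F \<otimes> a) \<oplus> d \<otimes> (F \<otimes> G \<otimes> (y \<otimes> a))"
          unfolding k using car car2 cd by algebra
        also have "\<dots> = F \<otimes> (x \<otimes> h)"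
          unfolding N h_def using car car2 cd by algebra
        finally have "fraction_at R q a x = fraction_at R q h ((f \<oplus> g) [^] k)"
          using car car2 h nq xF by (subst q.loc.fraction_eq_iff) auto
        then show ?thesis using 1 na q.primeideal_axioms by (simp add: P_def basic_open_def x_def)
      next
        case 2
        then have yG: "y \<notin> q" "G \<notin> q" using car q.pow_notin by (auto simp: y_def G_def)
        have "G \<otimes> ((f \<oplus> g) [^] k \<otimes> b) = c \<otimes> (F \<otimes> G \<otimes> (x \<otimes> b)) \<oplus> (d \<otimes> G \<otimes> y) \<otimes> (G \<otimes> b)"
          unfolding k using car car2 cd by algebra
        also have "\<dots> = G \<otimes> (y \<otimes> h)"
          unfolding N[symmetric] h_def using car car2 cd by algebra
        finally have "fraction_at R q b y = fraction_at R q h ((f \<oplus> g) [^] k)"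
          using car car2 h nq yG by (subst q.loc.fraction_eq_iff) auto
        then show ?thesis using 2 mb q.primeideal_axioms by (simp add: P_def basic_open_def y_def)
      qed
    qed
    then have "P (f \<oplus> g) k h" using h by (simp add: P_def)
    then show ?thesis using car by (auto simp: K_def)
  qed
  have outside: "\<exists>h\<in>K. h \<notin> p" if p: "primeideal p R" for p
  proof -
    have "p \<in> prime_ideals R" using p by (simp add: prime_ideals_def)
    with s obtain V a g where V: "zariski_open R V" "p \<in> V" "a \<in> carrier R" "g \<in> carrier R"
      "\<And>q. q \<in> V \<Longrightarrow> g \<notin> q" "\<And>q. q \<in> V \<Longrightarrow> s q = fraction_at R q a g"
      by (rule regular_functionsE) blast
    obtain h where h: "h \<in> carrier R" "p \<in> basic_open R h" "basic_open R h \<subseteq> V"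
      using V(1,2) by (rule zariski_open_contains_basic)
    \<comment> \<open>D(h) lies in V and hence in D(g), so g divides a power of h. This turns the
      local denominator g into a power of h, as \<open>P\<close> requires.\<close>
    have "h \<in> q" if "primeideal q R" "g \<in> q" for q
      using that h(3) V(5) by (auto simp: basic_open_def)
    from radical_member_principal[OF V(4) h(1) this]
    obtain n :: nat and c where c: "c \<in> carrier R" "h [^] n = c \<otimes> g" by blast
    have "s q = fraction_at R q (c \<otimes> a) (h [^] n)" if q: "q \<in> basic_open R h" for q
    proof -
      interpret q: primeideal q R using q by (simp add: basic_open_def)
      have "h \<notin> q" "g \<notin> q" using q h(3) V(5) by (auto simp: basic_open_def)
      then have "fraction_at R q a g = fraction_at R q (c \<otimes> a) (h [^] n)"
        using c(1) V(3,4) h(1) q.pow_notin[of h n]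
        by (intro q.loc.fraction_eqI) (auto simp: c(2) m_ac)
      then show ?thesis using q h(3) V(6) by auto
    qed
    then have "P h n (c \<otimes> a)" using c V(3) by (simp add: P_def)
    then show ?thesis using h by (auto simp: K_def basic_open_def)
  qed
  have "ideal K R"
  proof (rule idealI[OF ring_axioms])
    have z: "\<zero> \<in> K"
    proof -
      \<comment> \<open>D(0) is empty, so any numerator and exponent will do.\<close>
      have "P \<zero> 0 \<zero>"
        using additive_subgroup.zero_closed ideal.axioms(1) primeideal.axioms(1)
        unfolding P_def basic_open_def by blast
      then show ?thesis by (auto simp: K_def)
    qed
    show "subgroup K (add_monoid R)"
    proof (rule add.subgroupI)
      show "K \<subseteq> carrier R" by (auto simp: K_def)
      show "K \<noteq> {}" using z by blast
      show "\<ominus> f \<in> K" if "f \<in> K" for f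
      proof -
        have "f \<in> carrier R" using that by (simp add: K_def)
        then have "\<ominus> f = (\<ominus> \<one>) \<otimes> f" by algebra
        then show ?thesis using K_mult[OF that, of "\<ominus> \<one>"] by simp
      qed
    qed (use K_add in auto)
    fix f c assume f: "f \<in> K" "c \<in> carrier R"
    then show "c \<otimes> f \<in> K" using K_mult by blast
    moreover have "f \<in> carrier R" using f by (simp add: K_def)
    ultimately show "f \<otimes> c \<in> K" using f(2) m_comm by metis
  qed
  \<comment> \<open>No prime contains K, so 1 lies in K. The resulting denominator is a power of 1,
    and D(1) is the whole spectrum.\<close>
  from radical_member[OF this, of \<one>] outside have "\<one> \<in> K" by auto
  then obtain n a where "P \<one> n a" by (auto simp: K_def)
  then have a: "a \<in> carrier R" "\<And>q. q \<in> basic_open R \<one> \<Longrightarrow> s q = fraction_at R q a \<one>"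
    by (auto simp: P_def)
  have "s q = const_section R (prime_ideals R) a q" for q
  proof (cases "q \<in> prime_ideals R")
    case True
    then show ?thesis using a(2)[of q] primeideal.one_notin[of q R]
      by (simp add: basic_open_def prime_ideals_def const_section_def)
  next
    case False
    then show ?thesis using s by (auto simp: regular_functions_def const_section_def PiE_def extensional_def)
  qed
  with a(1) show ?thesis by blast
qed

section \<open>The ring cut out by an idempotent\<close>

text \<open>The factor eR, which is also R localized at e, realized as a subset of R. Its elements
  keep their type, as they must because \<open>unit_additive\<close> quantifies over rings on the
  type of the sections.\<close>

definition corner :: "('r, 'm) ring_scheme \<Rightarrow> 'r \<Rightarrow> ('r, 'm) ring_scheme"
  where "corner R e = R\<lparr>carrier := {x \<in> carrier R. e \<otimes>\<^bsub>R\<^esub> x = x}, one := e\<rparr>"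

lemma corner_simps [simp]:
  "x \<otimes>\<^bsub>corner R e\<^esub> y = x \<otimes>\<^bsub>R\<^esub> y"
  "x \<oplus>\<^bsub>corner R e\<^esub> y = x \<oplus>\<^bsub>R\<^esub> y"
  "\<one>\<^bsub>corner R e\<^esub> = e"
  "\<zero>\<^bsub>corner R e\<^esub> = \<zero>\<^bsub>R\<^esub>"
  by (simp_all add: corner_def)

lemma carrier_corner_iff: "x \<in> carrier (corner R e) \<longleftrightarrow> x \<in> carrier R \<and> e \<otimes>\<^bsub>R\<^esub> x = x"
  by (simp add: corner_def)

locale idempotent = cring +
  fixes e
  assumes e_carrier [simp, intro]: "e \<in> carrier R"
    and e_idem: "e \<otimes> e = e"
begin

abbreviation "E \<equiv> carrier (corner R e)"

lemma E_carrier: "x \<in> E \<Longrightarrow> x \<in> carrier R"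
  and E_absorb: "x \<in> E \<Longrightarrow> e \<otimes> x = x"
  by (simp_all add: carrier_corner_iff)

lemma e_mult_E [simp, intro]: "x \<in> carrier R \<Longrightarrow> e \<otimes> x \<in> E"
  using e_idem by (simp add: carrier_corner_iff m_assoc[symmetric])

lemma e_in_E [simp, intro]: "e \<in> E"
  using e_idem by (simp add: carrier_corner_iff)

lemma mult_E [simp, intro]: "\<lbrakk>x \<in> E; y \<in> carrier R\<rbrakk> \<Longrightarrow> x \<otimes> y \<in> E"
  by (simp add: carrier_corner_iff m_assoc[symmetric])

lemma add_E [simp, intro]: "\<lbrakk>x \<in> E; y \<in> E\<rbrakk> \<Longrightarrow> x \<oplus> y \<in> E"
  by (simp add: carrier_corner_iff r_distr)

lemma zero_E [simp, intro]: "\<zero> \<in> E"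
  by (simp add: carrier_corner_iff)

lemma cring_corner: "cring (corner R e)"
proof (rule cringI)
  show "abelian_group (corner R e)"
  proof (rule abelian_groupI)
    fix x assume x: "x \<in> E"
    then have "\<ominus> x \<in> E" "\<ominus> x \<oplus> x = \<zero>"
      by (simp_all add: carrier_corner_iff r_minus l_neg)
    then show "\<exists>y\<in>E. y \<oplus>\<^bsub>corner R e\<^esub> x = \<zero>\<^bsub>corner R e\<^esub>" by auto
  qed (auto simp: E_carrier a_ac)
  show "comm_monoid (corner R e)"
  proof (rule comm_monoidI)
    show "x \<otimes>\<^bsub>corner R e\<^esub> y = y \<otimes>\<^bsub>corner R e\<^esub> x" if "x \<in> E" "y \<in> E" for x y
      using that E_carrier m_comm by simp
  qed (auto simp: E_carrier E_absorb m_assoc)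
qed (auto simp: E_carrier l_distr)

section \<open>Primes and Zariski topology of the factor eR\<close>

lemma contraction_prime:
  assumes "p \<in> basic_open R e"
  shows "primeideal (p \<inter> E) (corner R e)"
proof -
  interpret p: primeideal p R using assms by (simp add: basic_open_def)
  interpret C: cring "corner R e" by (rule cring_corner)
  have ep: "e \<notin> p" using assms by (simp add: basic_open_def)
  \<comment> \<open>The negative in \<open>corner R e\<close> is taken from its own additive monoid;
    that it agrees with the negative in R follows from uniqueness of inverses.\<close>
  have neg: "\<ominus>\<^bsub>corner R e\<^esub> x = \<ominus> x" if x: "x \<in> E" for x
  proof -
    have "\<ominus> x \<in> E" using x by (simp add: carrier_corner_iff r_minus)
    moreover have "\<ominus> x \<oplus> x = \<zero>" using x E_carrier by (simp add: l_neg)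
    ultimately show ?thesis using x C.minus_equality[of "\<ominus> x" x] by simp
  qed
  have "subgroup (p \<inter> E) (add_monoid (corner R e))"
  proof (rule C.add.subgroupI)
    show "\<ominus>\<^bsub>corner R e\<^esub> x \<in> p \<inter> E" if "x \<in> p \<inter> E" for x
      using that neg p.a_inv_closed[of x] C.a_inv_closed[of x] by auto
    show "p \<inter> E \<noteq> {}"
      using additive_subgroup.zero_closed[OF ideal.axioms(1)[OF p.ideal_axioms]] zero_E by blast
  qed auto
  then have "ideal (p \<inter> E) (corner R e)"
    by (intro idealI) (auto simp: C.ring_axioms E_carrier p.I_l_closed p.I_r_closed
        intro: mult_E)
  then show ?thesis
  proof (rule primeidealI[OF _ cring_corner])
    show "E \<noteq> p \<inter> E" using ep by blast
    fix a b assume "a \<in> E" "b \<in> E" "a \<otimes>\<^bsub>corner R e\<^esub> b \<in> p \<inter> E"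
    then show "a \<in> p \<inter> E \<or> b \<in> p \<inter> E"
      using p.mult_mem_iff[of a b] E_carrier by auto
  qed
qed

text \<open>The preimage of q under the projection x -> ex of R onto eR. It will invert the
  contraction of primes from D(e) to eR.\<close>

definition extension :: "'a set \<Rightarrow> 'a set"
  where "extension q = {x \<in> carrier R. e \<otimes> x \<in> q}"

lemma extension_prime:
  assumes "primeideal q (corner R e)"
  shows "extension q \<in> basic_open R e"
proof -
  interpret q: primeideal q "corner R e" by (rule assms)
  have eq: "e \<notin> q" using q.one_notin by simp
  have zero: "\<zero> \<in> q"
    using additive_subgroup.zero_closed[OF ideal.axioms(1)[OF q.ideal_axioms]] by simp
  have add: "x \<oplus> y \<in> q" if "x \<in> q" "y \<in> q" for x y
    using additive_subgroup.a_closed[OF ideal.axioms(1)[OF q.ideal_axioms] that] by simp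
  have mult: "x \<otimes> y \<in> q" if "x \<in> q" "y \<in> E" for x y using q.I_r_closed[OF that] by simp
  \<comment> \<open>Idempotence makes the projection x -> ex multiplicative.\<close>
  have ee: "e \<otimes> (x \<otimes> y) = (e \<otimes> x) \<otimes> (e \<otimes> y)" if "x \<in> carrier R" "y \<in> carrier R" for x y
  proof -
    have "(e \<otimes> x) \<otimes> (e \<otimes> y) = (e \<otimes> e) \<otimes> (x \<otimes> y)" using that by (simp add: m_ac)
    then show ?thesis by (simp add: e_idem)
  qed
  have mult': "x \<otimes> y \<in> extension q" if x: "x \<in> extension q" and y: "y \<in> carrier R" for x y
    using x y mult[of "e \<otimes> x" "e \<otimes> y"] ee[of x y] by (simp add: extension_def)
  have "subgroup (extension q) (add_monoid R)"
  proof (rule add.subgroupI)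
    show "extension q \<noteq> {}" using zero by (auto simp: extension_def)
    show "\<ominus> x \<in> extension q" if "x \<in> extension q" for x
    proof -
      have x: "x \<in> carrier R" using that by (simp add: extension_def)
      then have "\<ominus> x = x \<otimes> (\<ominus> \<one>)" by algebra
      then show ?thesis using mult'[OF that, of "\<ominus> \<one>"] by simp
    qed
  qed (auto simp: extension_def r_distr intro: add)
  then have "ideal (extension q) R"
  proof (intro idealI ring_axioms)
    fix x y assume "x \<in> extension q" "y \<in> carrier R"
    then show "x \<otimes> y \<in> extension q" "y \<otimes> x \<in> extension q"
      using mult' m_comm[of y x] by (auto simp: extension_def)
  qed
  then have "primeideal (extension q) R"
  proof (rule primeidealI[OF _ is_cring])
    have "e \<notin> extension q" using eq e_idem by (simp add: extension_def)
    then show "carrier R \<noteq> extension q" using e_carrier by blast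
    fix a b assume ab: "a \<in> carrier R" "b \<in> carrier R" "a \<otimes> b \<in> extension q"
    then have "(e \<otimes> a) \<otimes>\<^bsub>corner R e\<^esub> (e \<otimes> b) \<in> q" using ee by (simp add: extension_def)
    then show "a \<in> extension q \<or> b \<in> extension q"
      using q.I_prime[of "e \<otimes> a" "e \<otimes> b"] ab by (simp add: extension_def)
  qed
  then show ?thesis using eq e_idem by (auto simp: basic_open_def extension_def)
qed

lemma contraction_extension:
  assumes "primeideal q (corner R e)"
  shows "extension q \<inter> E = q"
proof -
  interpret q: primeideal q "corner R e" by (rule assms)
  show ?thesis using q.Icarr E_carrier E_absorb by (auto simp: extension_def)
qed

lemma extension_contraction:
  assumes "p \<in> basic_open R e"
  shows "extension (p \<inter> E) = p"
proof -
  interpret p: primeideal p R using assms by (simp add: basic_open_def)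
  show ?thesis using assms p.mult_mem_iff[OF e_carrier] p.Icarr
    by (auto simp: extension_def basic_open_def)
qed

text \<open>The open part of D(e) that matches V under contraction, over which sections are
  compared.\<close>

definition pullback :: "'a set set \<Rightarrow> 'a set set"
  where "pullback V = {p \<in> basic_open R e. p \<inter> E \<in> V}"

lemma zariski_open_Int:
  "\<lbrakk>zariski_open Q U; zariski_open Q V\<rbrakk> \<Longrightarrow> zariski_open Q (U \<inter> V)"
  by (metis openin_Int openin_zariski_topology)

lemma zariski_open_pullback:
  assumes "zariski_open (corner R e) V"
  shows "zariski_open R (pullback V)"
proof -
  obtain F where F: "F \<subseteq> E" "V = prime_ideals (corner R e) - zero_locus (corner R e) F"
    using assms by (auto simp: zariski_open_def)
  have "pullback V = basic_open R e \<inter> (prime_ideals R - zero_locus R F)"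
    using F contraction_prime
    by (auto simp: pullback_def prime_ideals_def zero_locus_def basic_open_def)
  moreover have "zariski_open R (prime_ideals R - zero_locus R F)"
    using F(1) E_carrier unfolding zariski_open_def by blast
  ultimately show ?thesis
    using zariski_open_Int[OF zariski_open_basic[OF e_carrier]] by simp
qed

lemma zariski_open_extension_preimage:
  assumes "zariski_open R U"
  shows "zariski_open (corner R e) {q \<in> prime_ideals (corner R e). extension q \<in> U}"
proof -
  obtain F where F: "F \<subseteq> carrier R" "U = prime_ideals R - zero_locus R F"
    using assms by (auto simp: zariski_open_def)
  \<comment> \<open>The extension of q contains F exactly when q contains eF, and eF is a subset of
    eR as the topology there demands.\<close>
  have "{q \<in> prime_ideals (corner R e). extension q \<in> U}
      = prime_ideals (corner R e) - zero_locus (corner R e) ((\<lambda>x. e \<otimes> x) ` F)"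
    using F extension_prime
    by (auto simp: prime_ideals_def zero_locus_def basic_open_def extension_def)
  moreover have "(\<lambda>x. e \<otimes> x) ` F \<subseteq> E" using F(1) by auto
  ultimately show ?thesis unfolding zariski_open_def by blast
qed

lemma homeomorphic_contraction:
  "homeomorphic_map (subtopology (zariski_topology R) (basic_open R e))
     (zariski_topology (corner R e)) (\<lambda>p. p \<inter> E)"
proof -
  let ?X = "subtopology (zariski_topology R) (basic_open R e)" and ?Y = "zariski_topology (corner R e)"
  have top: "topspace ?X = basic_open R e" "topspace ?Y = prime_ideals (corner R e)"
    by (auto simp: topspace_zariski basic_open_def prime_ideals_def)
  have "continuous_map ?X ?Y (\<lambda>p. p \<inter> E)"
  proof (unfold continuous_map_def, intro conjI allI impI)
    show "(\<lambda>p. p \<inter> E) \<in> topspace ?X \<rightarrow> topspace ?Y"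
      unfolding top using contraction_prime by (auto simp: prime_ideals_def)
    fix V assume "openin ?Y V"
    then have "openin (zariski_topology R) (pullback V)"
      by (simp add: openin_zariski_topology zariski_open_pullback)
    then show "openin ?X {x \<in> topspace ?X. x \<inter> E \<in> V}"
      unfolding top openin_subtopology pullback_def by blast
  qed
  moreover have "continuous_map ?Y ?X extension"
  proof (unfold continuous_map_def, intro conjI allI impI)
    show "extension \<in> topspace ?Y \<rightarrow> topspace ?X"
      unfolding top using extension_prime by (auto simp: prime_ideals_def)
    fix U assume "openin ?X U"
    then have "zariski_open R U"
      using zariski_open_Int[OF _ zariski_open_basic[OF e_carrier]]
      by (auto simp: openin_subtopology openin_zariski_topology)
    then show "openin ?Y {x \<in> topspace ?Y. extension x \<in> U}"
      unfolding top openin_zariski_topology by (rule zariski_open_extension_preimage)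
  qed
  ultimately have "homeomorphic_maps ?X ?Y (\<lambda>p. p \<inter> E) extension"
    unfolding homeomorphic_maps_def top
    using extension_contraction contraction_extension by (auto simp: prime_ideals_def)
  then show ?thesis by (rule homeomorphic_maps_imp_map)
qed

text \<open>A multiplier u outside p may be replaced by eu, which is still outside p and lies in eR.
  So a class of pairs over eR is the trace of a class over R, and by the second equation every class
  over R at p has a representative with both entries in eR.\<close>

lemma fraction_corner:
  assumes p: "p \<in> basic_open R e" and car: "a \<in> carrier R" "g \<in> carrier R" "g \<notin> p"
  shows "fraction_at (corner R e) (p \<inter> E) (e \<otimes> a) (e \<otimes> g) = fraction_at R p a g \<inter> (E \<times> E)"
    and "fraction_at R p (e \<otimes> a) (e \<otimes> g) = fraction_at R p a g"
proof -
  interpret p: primeideal p R using p by (simp add: basic_open_def)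
  interpret P: primeideal "p \<inter> E" "corner R e" using p by (rule contraction_prime)
  have ep: "e \<notin> p" using p by (simp add: basic_open_def)
  have eg: "e \<otimes> g \<in> E - p \<inter> E" using car ep by (simp add: p.mult_mem_iff)
  have "(b, t) \<in> fraction_at (corner R e) (p \<inter> E) (e \<otimes> a) (e \<otimes> g) \<longleftrightarrow>
      (b, t) \<in> fraction_at R p a g \<inter> (E \<times> E)" for b t
  proof (cases "b \<in> E \<and> t \<in> E")
    case True
    note bt = True[THEN conjunct1] True[THEN conjunct2]
    have eq: "u \<otimes> (t \<otimes> (e \<otimes> a)) = (e \<otimes> u) \<otimes> (t \<otimes> a)"
      "u \<otimes> ((e \<otimes> g) \<otimes> b) = (e \<otimes> u) \<otimes> (g \<otimes> b)" if "u \<in> carrier R" for u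
      using that bt[THEN E_carrier] car by (simp_all add: m_ac)
    have "(\<exists>u\<in>E - p \<inter> E. u \<otimes> (t \<otimes> (e \<otimes> a)) = u \<otimes> ((e \<otimes> g) \<otimes> b)) \<longleftrightarrow>
        (\<exists>u\<in>carrier R - p. u \<otimes> (t \<otimes> a) = u \<otimes> (g \<otimes> b))"
    proof
      assume "\<exists>u\<in>E - p \<inter> E. u \<otimes> (t \<otimes> (e \<otimes> a)) = u \<otimes> ((e \<otimes> g) \<otimes> b)"
      then obtain u where "u \<in> E" "u \<notin> p" "u \<otimes> (t \<otimes> (e \<otimes> a)) = u \<otimes> ((e \<otimes> g) \<otimes> b)" by blast
      then have "u \<in> carrier R - p" "u \<otimes> (t \<otimes> a) = u \<otimes> (g \<otimes> b)"
        using eq[of u] E_carrier E_absorb by auto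
      then show "\<exists>u\<in>carrier R - p. u \<otimes> (t \<otimes> a) = u \<otimes> (g \<otimes> b)" by blast
    next
      assume "\<exists>u\<in>carrier R - p. u \<otimes> (t \<otimes> a) = u \<otimes> (g \<otimes> b)"
      then obtain u where u: "u \<in> carrier R" "u \<notin> p" "u \<otimes> (t \<otimes> a) = u \<otimes> (g \<otimes> b)" by blast
      have "(e \<otimes> u) \<otimes> (t \<otimes> (e \<otimes> a)) = (e \<otimes> e) \<otimes> (u \<otimes> (t \<otimes> a))"
        using u(1) bt[THEN E_carrier] car by (simp add: m_ac)
      also have "\<dots> = (e \<otimes> u) \<otimes> ((e \<otimes> g) \<otimes> b)"
        unfolding u(3) using u(1) bt[THEN E_carrier] car by (simp add: m_ac)
      finally have "(e \<otimes> u) \<otimes> (t \<otimes> (e \<otimes> a)) = (e \<otimes> u) \<otimes> ((e \<otimes> g) \<otimes> b)" .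
      moreover have "e \<otimes> u \<in> E - p \<inter> E" using u ep by (simp add: p.mult_mem_iff)
      ultimately show "\<exists>u\<in>E - p \<inter> E. u \<otimes> (t \<otimes> (e \<otimes> a)) = u \<otimes> ((e \<otimes> g) \<otimes> b)" by blast
    qed
    then show ?thesis
      using bt bt[THEN E_carrier] car eg by (auto simp: P.loc.mem_fraction_iff p.loc.mem_fraction_iff)
  next
    case False
    then show ?thesis using car eg by (auto simp: P.loc.mem_fraction_iff)
  qed
  then show "fraction_at (corner R e) (p \<inter> E) (e \<otimes> a) (e \<otimes> g) = fraction_at R p a g \<inter> (E \<times> E)"
    by auto
  show "fraction_at R p (e \<otimes> a) (e \<otimes> g) = fraction_at R p a g"
    using car eg by (intro p.loc.fraction_eqI) (auto simp: m_ac)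
qed

lemma fraction_corner_E:
  assumes p: "p \<in> basic_open R e" and car: "a \<in> E" "g \<in> E" "g \<notin> p"
  shows "fraction_at (corner R e) (p \<inter> E) a g = fraction_at R p a g \<inter> (E \<times> E)"
  using fraction_corner(1)[OF p, of a g] car E_carrier E_absorb by simp

text \<open>Saturating a class of pairs over eR to one over R realizes the natural map between the
  two localizations; intersecting with \<open>E\<close> x \<open>E\<close> leads back.\<close>

definition loc_extend :: "'a set \<Rightarrow> ('a \<times> 'a) set \<Rightarrow> ('a \<times> 'a) set"
  where "loc_extend p X = loc_rel R (carrier R - p) `` X"

lemma loc_extend_fraction:
  assumes p: "p \<in> basic_open R e" and car: "a \<in> E" "g \<in> E" "g \<notin> p"
  shows "loc_extend p (fraction_at (corner R e) (p \<inter> E) a g) = fraction_at R p a g"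
proof -
  interpret p: primeideal p R using p by (simp add: basic_open_def)
  let ?r = "loc_rel R (carrier R - p)"
  have "?r `` (fraction_at R p a g \<inter> (E \<times> E)) \<subseteq> ?r `` {(a, g)}"
    using p.loc.equiv_loc_rel unfolding fraction_def equiv_def by (blast dest: transD)
  moreover have "(a, g) \<in> fraction_at R p a g \<inter> (E \<times> E)"
    using car E_carrier by (simp add: p.loc.self_mem_fraction)
  ultimately show ?thesis
    unfolding loc_extend_def fraction_corner_E[OF assms] by (auto simp: fraction_def)
qed

section \<open>Sections over the spectrum of eR and over D(e)\<close>

definition section_extend ::
    "'a set set \<Rightarrow> ('a set \<Rightarrow> ('a \<times> 'a) set) \<Rightarrow> 'a set \<Rightarrow> ('a \<times> 'a) set"
  where "section_extend V s = (\<lambda>p\<in>pullback V. loc_extend p (s (p \<inter> E)))"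

text \<open>One pair (a, g) serves for the value of s and for the extended value, so that the proofs
  about \<open>section_extend\<close> can compute with explicit fractions.\<close>

lemma regular_value:
  assumes "s \<in> regular_functions (corner R e) V" "p \<in> pullback V"
  obtains a g where "a \<in> E" "g \<in> E" "g \<notin> p" "s (p \<inter> E) = fraction_at (corner R e) (p \<inter> E) a g"
    "section_extend V s p = fraction_at R p a g"
proof -
  have p: "p \<in> basic_open R e" "p \<inter> E \<in> V" using assms(2) by (auto simp: pullback_def)
  obtain W a g where W: "p \<inter> E \<in> W" "a \<in> E" "g \<in> E" "\<And>q. q \<in> W \<Longrightarrow> g \<notin> q"
    "\<And>q. q \<in> W \<Longrightarrow> s q = fraction_at (corner R e) q a g"
    using assms(1) p(2) by (rule regular_functionsE) blast
  then have "g \<notin> p" by blast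
  with W p assms(2) show ?thesis
    by (intro that[of a g]) (auto simp: section_extend_def loc_extend_fraction)
qed

lemma section_extend_closed:
  assumes V: "zariski_open (corner R e) V" and s: "s \<in> regular_functions (corner R e) V"
  shows "section_extend V s \<in> regular_functions R (pullback V)"
proof -
  have "section_extend V s p \<in> carrier (loc_at R p)" if p: "p \<in> pullback V" for p
  proof -
    interpret p: primeideal p R using p by (simp add: pullback_def basic_open_def)
    from s p obtain a g where "a \<in> E" "g \<in> E" "g \<notin> p" "section_extend V s p = fraction_at R p a g"
      by (rule regular_value)
    then show ?thesis using E_carrier p.loc.fraction_closed by auto
  qed
  moreover have "\<exists>W. zariski_open R W \<and> p \<in> W \<and> W \<subseteq> pullback V \<and>
      (\<exists>a\<in>carrier R. \<exists>g\<in>carrier R. \<forall>q\<in>W. g \<notin> q \<and> section_extend V s q = fraction_at R q a g)"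
    if p: "p \<in> pullback V" for p
  proof -
    have "p \<inter> E \<in> V" using p by (simp add: pullback_def)
    with s obtain W a g where W: "zariski_open (corner R e) W" "p \<inter> E \<in> W" "W \<subseteq> V" "a \<in> E" "g \<in> E"
      "\<And>q. q \<in> W \<Longrightarrow> g \<notin> q" "\<And>q. q \<in> W \<Longrightarrow> s q = fraction_at (corner R e) q a g"
      by (rule regular_functionsE) blast
    have "g \<notin> q \<and> section_extend V s q = fraction_at R q a g" if q: "q \<in> pullback W" for q
    proof -
      have q': "q \<in> basic_open R e" "q \<inter> E \<in> W" "q \<in> pullback V"
        using q W(3) by (auto simp: pullback_def)
      then have "g \<notin> q" using W(5,6) by blast
      then show ?thesis using q' W by (simp add: section_extend_def loc_extend_fraction)
    qed
    moreover have "p \<in> pullback W" "pullback W \<subseteq> pullback V"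
      using p W(2,3) by (auto simp: pullback_def)
    ultimately show ?thesis
      using zariski_open_pullback[OF W(1)] W(4,5)[THEN E_carrier] by blast
  qed
  ultimately show ?thesis
    unfolding regular_functions_def by (auto simp: section_extend_def)
qed

lemma section_extend_hom:
  assumes V: "zariski_open (corner R e) V"
  shows "section_extend V \<in> ring_hom (structure_ring (corner R e) V) (structure_ring R (pullback V))"
proof (rule ring_hom_memI)
  fix s t assume "s \<in> carrier (structure_ring (corner R e) V)"
    and "t \<in> carrier (structure_ring (corner R e) V)"
  then have s: "s \<in> regular_functions (corner R e) V" and t: "t \<in> regular_functions (corner R e) V"
    by (simp_all add: structure_ring_def)
  show "section_extend V s \<in> carrier (structure_ring R (pullback V))"
    using section_extend_closed[OF V s] by (simp add: structure_ring_def)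
  have *: "loc_extend p (s (p \<inter> E) \<otimes>\<^bsub>loc_at (corner R e) (p \<inter> E)\<^esub> t (p \<inter> E))
       = section_extend V s p \<otimes>\<^bsub>loc_at R p\<^esub> section_extend V t p \<and>
       loc_extend p (s (p \<inter> E) \<oplus>\<^bsub>loc_at (corner R e) (p \<inter> E)\<^esub> t (p \<inter> E))
       = section_extend V s p \<oplus>\<^bsub>loc_at R p\<^esub> section_extend V t p"
    if p: "p \<in> pullback V" for p
  proof -
    have pe: "p \<in> basic_open R e" using p by (simp add: pullback_def)
    interpret p: primeideal p R using pe by (simp add: basic_open_def)
    interpret P: primeideal "p \<inter> E" "corner R e" using pe by (rule contraction_prime)
    obtain a g where a: "a \<in> E" "g \<in> E" "g \<notin> p" "s (p \<inter> E) = fraction_at (corner R e) (p \<inter> E) a g"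
      "section_extend V s p = fraction_at R p a g"
      using s p by (rule regular_value)
    obtain b h where b: "b \<in> E" "h \<in> E" "h \<notin> p" "t (p \<inter> E) = fraction_at (corner R e) (p \<inter> E) b h"
      "section_extend V t p = fraction_at R p b h"
      using t p by (rule regular_value)
    note car = a(1,2)[THEN E_carrier] b(1,2)[THEN E_carrier]
    have gh: "g \<otimes> h \<notin> p" using a b car by (simp add: p.mult_mem_iff)
    show ?thesis
      using a b car gh
      by (simp add: P.loc.mult_fraction P.loc.add_fraction p.loc.mult_fraction p.loc.add_fraction
          loc_extend_fraction[OF pe])
  qed
  then show "section_extend V (s \<otimes>\<^bsub>structure_ring (corner R e) V\<^esub> t)
      = section_extend V s \<otimes>\<^bsub>structure_ring R (pullback V)\<^esub> section_extend V t"
    "section_extend V (s \<oplus>\<^bsub>structure_ring (corner R e) V\<^esub> t)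
      = section_extend V s \<oplus>\<^bsub>structure_ring R (pullback V)\<^esub> section_extend V t"
    by (auto simp: structure_ring_def fun_eq_iff section_extend_def pullback_def)
next
  have "loc_extend p (fraction_at (corner R e) (p \<inter> E) e e) = fraction_at R p \<one> \<one>"
    if p: "p \<in> pullback V" for p
  proof -
    have pe: "p \<in> basic_open R e" using p by (simp add: pullback_def)
    interpret p: primeideal p R using pe by (simp add: basic_open_def)
    show ?thesis
      using loc_extend_fraction[OF pe, of e e] fraction_corner(2)[OF pe, of \<one> \<one>] pe p.one_notin
      by (simp add: basic_open_def)
  qed
  then show "section_extend V \<one>\<^bsub>structure_ring (corner R e) V\<^esub> = \<one>\<^bsub>structure_ring R (pullback V)\<^esub>"
    by (auto simp: structure_ring_def section_extend_def fun_eq_iff one_localization pullback_def)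
qed

text \<open>A value of s is the trace on \<open>E\<close> x \<open>E\<close> of the extended value
  and so can be recovered from it; every q in V is reached, being the contraction of
  \<open>extension q\<close>.\<close>

lemma section_extend_inj:
  assumes V: "zariski_open (corner R e) V"
  shows "inj_on (section_extend V) (regular_functions (corner R e) V)"
proof (rule inj_onI)
  fix s t assume s: "s \<in> regular_functions (corner R e) V" and t: "t \<in> regular_functions (corner R e) V"
    and eq: "section_extend V s = section_extend V t"
  have "s q = t q" if q: "q \<in> V" for q
  proof -
    define p where "p = extension q"
    have prime: "primeideal q (corner R e)" using V q by (rule zariski_openD)
    have pe: "p \<in> basic_open R e" "p \<inter> E = q"
      unfolding p_def using extension_prime[OF prime] contraction_extension[OF prime] by auto
    then have p: "p \<in> pullback V" using q by (simp add: pullback_def)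
    obtain a g where a: "a \<in> E" "g \<in> E" "g \<notin> p" "s (p \<inter> E) = fraction_at (corner R e) (p \<inter> E) a g"
      "section_extend V s p = fraction_at R p a g"
      using s p by (rule regular_value)
    obtain b h where b: "b \<in> E" "h \<in> E" "h \<notin> p" "t (p \<inter> E) = fraction_at (corner R e) (p \<inter> E) b h"
      "section_extend V t p = fraction_at R p b h"
      using t p by (rule regular_value)
    have "fraction_at R p a g = fraction_at R p b h" using a b eq by simp
    then have "s (p \<inter> E) = t (p \<inter> E)"
      using a(1-4) b(1-4) by (simp add: fraction_corner_E[OF pe(1)])
    then show ?thesis by (simp add: pe(2))
  qed
  then show "s = t"
    using s t by (auto simp: regular_functions_def intro: PiE_ext)
qed

lemma section_extend_surj:
  assumes V: "zariski_open (corner R e) V" and \<sigma>: "\<sigma> \<in> regular_functions R (pullback V)"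
  shows "\<sigma> \<in> section_extend V ` regular_functions (corner R e) V"
proof -
  \<comment> \<open>The trace on \<open>E\<close> x \<open>E\<close> inverts
    \<open>loc_extend\<close> at each prime.\<close>
  define s where "s = (\<lambda>q\<in>V. \<sigma> (extension q) \<inter> (E \<times> E))"
  have in_pullback: "extension q \<in> pullback V" "extension q \<in> basic_open R e" "extension q \<inter> E = q"
    "primeideal q (corner R e)" if q: "q \<in> V" for q
  proof -
    show prime: "primeideal q (corner R e)" using V q by (rule zariski_openD)
    show "extension q \<in> basic_open R e" "extension q \<inter> E = q"
      using extension_prime[OF prime] contraction_extension[OF prime] by auto
    then show "extension q \<in> pullback V" using q by (simp add: pullback_def)
  qed
  have loc: "\<exists>W a g. zariski_open (corner R e) W \<and> q \<in> W \<and> W \<subseteq> V \<and> a \<in> E \<and> g \<in> E \<and>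
      (\<forall>r\<in>W. g \<notin> r \<and> s r = fraction_at (corner R e) r a g \<and> \<sigma> (extension r) = fraction_at R (extension r) a g)"
    if q: "q \<in> V" for q
  proof -
    obtain W a g where W: "zariski_open R W" "extension q \<in> W" "W \<subseteq> pullback V" "a \<in> carrier R" "g \<in> carrier R"
      "\<And>q. q \<in> W \<Longrightarrow> g \<notin> q" "\<And>q. q \<in> W \<Longrightarrow> \<sigma> q = fraction_at R q a g"
      using \<sigma> in_pullback(1)[OF q] by (rule regular_functionsE) blast
    define W' where "W' = {q \<in> prime_ideals (corner R e). extension q \<in> W}"
    have "r \<in> V" if "r \<in> W'" for r
      using that W(3) contraction_extension[of r] by (auto simp: W'_def pullback_def prime_ideals_def)
    then have sub: "W' \<subseteq> V" by blast
    \<comment> \<open>Expanding by e leaves the class over R unchanged and moves the local numerator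
      and denominator into eR.\<close>
    have "e \<otimes> g \<notin> r \<and> s r = fraction_at (corner R e) r (e \<otimes> a) (e \<otimes> g)
        \<and> \<sigma> (extension r) = fraction_at R (extension r) (e \<otimes> a) (e \<otimes> g)" if r: "r \<in> W'" for r
    proof -
      have rW: "extension r \<in> W" and rV: "r \<in> V" using r sub by (auto simp: W'_def)
      have g: "g \<notin> extension r" using W(6) rW by blast
      have "\<sigma> (extension r) = fraction_at R (extension r) a g" using W(7) rW by blast
      moreover have "e \<otimes> g \<notin> r" using g W(5) by (simp add: extension_def)
      ultimately show ?thesis
        using fraction_corner[OF in_pullback(2)[OF rV] W(4,5) g] in_pullback(3)[OF rV] rV
        by (simp add: s_def)
    qed
    moreover have "q \<in> W'" using W(2) in_pullback(4)[OF q] by (simp add: W'_def prime_ideals_def)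
    moreover have "zariski_open (corner R e) W'"
      unfolding W'_def by (rule zariski_open_extension_preimage[OF W(1)])
    moreover have "e \<otimes> a \<in> E" "e \<otimes> g \<in> E" using W(4,5) by auto
    ultimately show ?thesis using sub
      by (intro exI[of _ W'] exI[of _ "e \<otimes> a"] exI[of _ "e \<otimes> g"] conjI ballI) auto
  qed
  have "s q \<in> carrier (loc_at (corner R e) q)" if q: "q \<in> V" for q
  proof -
    interpret q: primeideal q "corner R e" using in_pullback(4)[OF q] .
    obtain a g where "a \<in> E" "g \<in> E" "g \<notin> q" "s q = fraction_at (corner R e) q a g"
      using loc[OF q] by blast
    then show ?thesis using q.loc.fraction_closed by simp
  qed
  moreover have "\<exists>W. zariski_open (corner R e) W \<and> q \<in> W \<and> W \<subseteq> V \<and>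
      (\<exists>a\<in>E. \<exists>g\<in>E. \<forall>r\<in>W. g \<notin> r \<and> s r = fraction_at (corner R e) r a g)"
    if q: "q \<in> V" for q
    using loc[OF q] by meson
  ultimately have reg: "s \<in> regular_functions (corner R e) V"
    unfolding regular_functions_def by (auto simp: s_def)
  have "section_extend V s p = \<sigma> p" if p: "p \<in> pullback V" for p
  proof -
    have pe: "p \<in> basic_open R e" "p \<inter> E \<in> V" using p by (auto simp: pullback_def)
    obtain a g where "a \<in> E" "g \<in> E" "g \<notin> p \<inter> E" "s (p \<inter> E) = fraction_at (corner R e) (p \<inter> E) a g"
      "\<sigma> p = fraction_at R p a g"
      using loc[OF pe(2)] extension_contraction[OF pe(1)] by metis
    then show ?thesis using p pe(1) by (auto simp: section_extend_def loc_extend_fraction)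
  qed
  moreover have "section_extend V s \<in> extensional (pullback V)" "\<sigma> \<in> extensional (pullback V)"
    using \<sigma> by (auto simp: section_extend_def regular_functions_def PiE_def)
  ultimately have "section_extend V s = \<sigma>"
    by (intro extensionalityI)
  with reg show ?thesis by blast
qed

lemma section_extend_iso:
  assumes "zariski_open (corner R e) V"
  shows "section_extend V \<in> ring_iso (structure_ring (corner R e) V) (structure_ring R (pullback V))"
proof -
  have "bij_betw (section_extend V) (regular_functions (corner R e) V) (regular_functions R (pullback V))"
    using section_extend_inj[OF assms] section_extend_surj[OF assms] section_extend_closed[OF assms]
    by (auto simp: bij_betw_def)
  then show ?thesis
    using section_extend_hom[OF assms] by (simp add: ring_iso_def structure_ring_def)
qed

text \<open>The point map is f followed by contraction. The sheaf map runs in the opposite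
  direction: \<open>section_extend\<close> goes from the spectrum of eR to D(e), and
  \<open>\<phi>\<close> from there to X.\<close>

lemma iso_corner:
  assumes iso: "iso_ringed_spaces X (Spec R) f \<phi>" and W: "openin (points X) W"
    and fW: "f ` W = basic_open R e"
  shows "iso_ringed_spaces (open_subspace X W) (Spec (corner R e))
    (\<lambda>x. f x \<inter> E) (\<lambda>V. \<phi> (pullback V) \<circ> section_extend V)"
proof -
  have hom: "homeomorphic_map (points X) (zariski_topology R) f"
    and phi: "\<And>V. zariski_open R V \<Longrightarrow>
      \<phi> V \<in> ring_iso (structure_ring R V) (sections X (f -` V \<inter> topspace (points X)))"
    and nat: "\<And>V W s. \<lbrakk>zariski_open R V; zariski_open R W; W \<subseteq> V; s \<in> carrier (structure_ring R V)\<rbrakk> \<Longrightarrow>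
      \<phi> W (restrict s W) = rest X (f -` V \<inter> topspace (points X)) (f -` W \<inter> topspace (points X)) (\<phi> V s)"
    using iso by (auto simp: iso_ringed_spaces_def Spec_def openin_zariski_topology)
  have sub: "W \<subseteq> topspace (points X)" using W by (rule openin_subset)
  have inj: "inj_on f (topspace (points X))" and img: "f ` topspace (points X) = prime_ideals R"
    using hom by (auto simp: homeomorphic_eq_everything_map topspace_zariski)
  have mem: "x \<in> W \<longleftrightarrow> f x \<in> basic_open R e" if "x \<in> topspace (points X)" for x
    using that fW inj sub by (metis image_eqI inj_on_image_mem_iff)
  have "homeomorphic_map (subtopology (points X) W) (subtopology (zariski_topology R) (basic_open R e)) f"
  proof (rule homeomorphic_map_subtopologies[OF hom])
    show "f ` (topspace (points X) \<inter> W) = topspace (zariski_topology R) \<inter> basic_open R e"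
      using fW sub by (auto simp: topspace_zariski basic_open_def prime_ideals_def Int_absorb1)
  qed
  from homeomorphic_map_compose[OF this homeomorphic_contraction]
  have "homeomorphic_map (subtopology (points X) W) (zariski_topology (corner R e)) (\<lambda>x. f x \<inter> E)"
    by (simp add: o_def)
  \<comment> \<open>A point that f sends into D(e) already lies in W, so preimages taken in W and in
    X agree.\<close>
  moreover have pre: "(\<lambda>x. f x \<inter> E) -` V \<inter> topspace (subtopology (points X) W)
      = f -` pullback V \<inter> topspace (points X)" for V
    using mem sub by (auto simp: pullback_def)
  have "\<phi> (pullback V) \<circ> section_extend V \<in>
      ring_iso (structure_ring (corner R e) V) (sections X (f -` pullback V \<inter> topspace (points X)))"
    if "zariski_open (corner R e) V" for V
    by (rule ring_iso_set_trans[OF section_extend_iso[OF that] phi[OF zariski_open_pullback[OF that]]])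
  moreover have "\<phi> (pullback W') (section_extend W' (restrict s W'))
      = rest X (f -` pullback V \<inter> topspace (points X)) (f -` pullback W' \<inter> topspace (points X))
          (\<phi> (pullback V) (section_extend V s))"
    if V: "zariski_open (corner R e) V" "zariski_open (corner R e) W'" "W' \<subseteq> V"
      and s: "s \<in> carrier (structure_ring (corner R e) V)" for V W' s
  proof -
    have "pullback W' \<subseteq> pullback V" using V(3) by (auto simp: pullback_def)
    moreover from this have "section_extend W' (restrict s W') = restrict (section_extend V s) (pullback W')"
      by (auto simp: section_extend_def fun_eq_iff pullback_def)
    moreover have "section_extend V s \<in> carrier (structure_ring R (pullback V))"
      using section_extend_closed[OF V(1)] s by (simp add: structure_ring_def)
    ultimately show ?thesis
      using nat[OF V(1,2)[THEN zariski_open_pullback]] by simp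
  qed
  ultimately show ?thesis
    unfolding iso_ringed_spaces_def
    by (simp add: open_subspace_def Spec_def openin_zariski_topology pre[simplified])
qed

end

section \<open>Unit-additivity\<close>

context idempotent
begin

lemma corner_unitI:
  assumes w: "w \<in> E" and c: "c \<in> carrier R" "c \<otimes> w = e"
  shows "w \<in> Units (corner R e)"
proof -
  \<comment> \<open>The inverse has to lie in eR, so c is replaced by ec.\<close>
  have "e \<otimes> c \<otimes> w = e" using c w[THEN E_carrier] by (simp add: m_assoc e_idem)
  moreover have "w \<otimes> (e \<otimes> c) = e \<otimes> c \<otimes> w" using c(1) w[THEN E_carrier] by (simp add: m_ac)
  ultimately show ?thesis using w c(1) unfolding Units_def by auto
qed

lemma corner_nilpotent:
  assumes w: "w \<in> E" and "nilpotent_elem R w"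
  shows "nilpotent_elem (corner R e) w"
proof -
  \<comment> \<open>The factor e accounts for the exponent 0, where the power in
    \<open>corner R e\<close> is e and not 1.\<close>
  have pow: "w [^]\<^bsub>corner R e\<^esub> n = e \<otimes> w [^] n" for n :: nat
    using w[THEN E_carrier] by (induction n) (simp_all add: m_assoc)
  obtain n :: nat where "0 < n" "w [^] n = \<zero>" using assms(2) by (auto simp: nilpotent_elem_def)
  then show ?thesis using w unfolding nilpotent_elem_def pow by auto
qed

text \<open>In the decomposition of R into eR and (1 - e)R the element has the components u and s(1
  - e). Its inverse has the components u' and s(1 - e), because s squares to 1.\<close>

lemma unit_lift:
  assumes u: "u \<in> Units (corner R e)" and s: "s \<in> carrier R" "s \<otimes> s = \<one>"
  shows "u \<oplus> s \<otimes> (\<one> \<ominus> e) \<in> Units R"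
proof -
  obtain u' where u': "u' \<in> E" "u \<otimes> u' = e" and uE: "u \<in> E"
    using u by (auto simp: Units_def)
  have car: "u \<in> carrier R" "u' \<in> carrier R" using uE u'(1) by (auto intro: E_carrier)
  have eu: "e \<otimes> u = u" "e \<otimes> u' = u'" using uE u'(1) by (auto intro: E_absorb)
  define d where "d = \<one> \<ominus> e"
  have d: "d \<in> carrier R" by (simp add: d_def)
  \<comment> \<open>Elements of eR are orthogonal to 1 - e, so the mixed terms of the product below
    vanish.\<close>
  have xd: "x \<otimes> d = \<zero>" if "x \<in> carrier R" "e \<otimes> x = x" for x
  proof -
    have "x \<otimes> d = x \<ominus> e \<otimes> x" unfolding d_def using that(1) e_carrier by algebra
    then show ?thesis using that by (simp add: r_right_minus_eq)
  qed
  have dd: "d \<otimes> d = d"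
  proof -
    have "d \<otimes> d = d \<ominus> e \<otimes> d" unfolding d_def using e_carrier by algebra
    then show ?thesis using xd[OF e_carrier e_idem] d by (simp add: minus_eq)
  qed
  have "(u \<oplus> s \<otimes> d) \<otimes> (u' \<oplus> s \<otimes> d)
      = u \<otimes> u' \<oplus> s \<otimes> (u \<otimes> d) \<oplus> s \<otimes> (u' \<otimes> d) \<oplus> (s \<otimes> s) \<otimes> (d \<otimes> d)"
    using car s(1) d by algebra
  also have "\<dots> = e \<oplus> d"
    using xd car eu s u'(2) dd d by simp
  also have "\<dots> = \<one>" unfolding d_def using e_carrier by algebra
  finally have inv: "(u \<oplus> s \<otimes> d) \<otimes> (u' \<oplus> s \<otimes> d) = \<one>" .
  have "u \<oplus> s \<otimes> d \<in> carrier R" "u' \<oplus> s \<otimes> d \<in> carrier R" using car s(1) d by auto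
  with inv m_comm[OF this] have "u \<oplus> s \<otimes> d \<in> Units R" unfolding Units_def by auto
  then show ?thesis by (simp add: d_def)
qed

text \<open>The components of \<open>u\<close> and \<open>v\<close> in the complementary factor of \<open>R\<close> are taken to be \<open>1\<close> and
  \<open>-1\<close>, so that the sum of the lifted units is still \<open>u + v\<close>.\<close>

lemma units_lift:
  assumes "u \<in> Units (corner R e)" "v \<in> Units (corner R e)"
  obtains u' v' where "u' \<in> Units R" "v' \<in> Units R" "u' \<oplus> v' = u \<oplus> v"
proof
  show "u \<oplus> \<one> \<otimes> (\<one> \<ominus> e) \<in> Units R" "v \<oplus> (\<ominus> \<one>) \<otimes> (\<one> \<ominus> e) \<in> Units R"
    using unit_lift[OF assms(1), of \<one>] unit_lift[OF assms(2), of "\<ominus> \<one>"] by (simp_all add: l_minus)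
  have "u \<in> carrier R" "v \<in> carrier R" using assms E_carrier by (auto simp: Units_def)
  then show "(u \<oplus> \<one> \<otimes> (\<one> \<ominus> e)) \<oplus> (v \<oplus> (\<ominus> \<one>) \<otimes> (\<one> \<ominus> e)) = u \<oplus> v"
    using e_carrier by algebra
qed

lemma corner_add_Units: "\<lbrakk>u \<in> Units (corner R e); v \<in> Units (corner R e)\<rbrakk> \<Longrightarrow> u \<oplus> v \<in> E"
  by (auto simp: Units_def)

lemma unit_additive_corner:
  assumes "unit_additive_ring R"
  shows "unit_additive_ring (corner R e)"
  unfolding unit_additive_ring_def
proof (intro conjI cring_corner ballI)
  fix u v assume uv: "u \<in> Units (corner R e)" "v \<in> Units (corner R e)"
  then obtain u' v' where "u' \<in> Units R" "v' \<in> Units R" "u' \<oplus> v' = u \<oplus> v"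
    by (rule units_lift)
  then have "u \<oplus> v \<in> Units R \<or> nilpotent_elem R (u \<oplus> v)"
    using assms unfolding unit_additive_ring_def by metis
  then have "u \<oplus> v \<in> Units (corner R e) \<or> nilpotent_elem (corner R e) (u \<oplus> v)"
  proof
    assume w: "u \<oplus> v \<in> Units R"
    then have "(e \<otimes> inv (u \<oplus> v)) \<otimes> (u \<oplus> v) = e"
      using Units_closed[OF w] by (simp add: m_assoc)
    then show ?thesis
      using corner_unitI[OF corner_add_Units[OF uv], of "e \<otimes> inv (u \<oplus> v)"] w by auto
  qed (use corner_nilpotent corner_add_Units uv in blast)
  then show "u \<oplus>\<^bsub>corner R e\<^esub> v \<in> Units (corner R e) \<or> nilpotent_elem (corner R e) (u \<oplus>\<^bsub>corner R e\<^esub> v)"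
    by simp
qed

end

text \<open>The homeomorphism carries W to a clopen subset of the spectrum, which an idempotent cuts
  out. The equation for the image of W stays in the conclusion because the argument on components
  works with the primes in that image.\<close>

lemma iso_clopen_corner:
  assumes R: "cring R" and iso: "iso_ringed_spaces X (Spec R) f \<phi>"
    and W: "openin (points X) W" "closedin (points X) W"
  obtains e where "idempotent R e" "f ` W = basic_open R e"
    "isomorphic_ringed_spaces (open_subspace X W) (Spec (corner R e))"
proof -
  interpret cring R by (rule R)
  have hom: "homeomorphic_map (points X) (zariski_topology R) f"
    using iso by (auto simp: iso_ringed_spaces_def Spec_def)
  have "zariski_open R (f ` W)"
    using hom W(1) homeomorphic_map_openness openin_subset by (metis openin_zariski_topology)
  moreover have "openin (zariski_topology R) (topspace (zariski_topology R) - f ` W)"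
    using hom W(2) homeomorphic_map_closedness closedin_subset by (metis closedin_def)
  then have "zariski_open R (prime_ideals R - f ` W)"
    by (simp add: topspace_zariski openin_zariski_topology)
  ultimately obtain e where e: "e \<in> carrier R" "e \<otimes>\<^bsub>R\<^esub> e = e" "f ` W = basic_open R e"
    by (rule clopen_idempotent)
  interpret idempotent R e by unfold_locales (use e in auto)
  have "isomorphic_ringed_spaces (open_subspace X W) (Spec (corner R e))"
    using iso_corner[OF iso W(1) e(3)] by (auto simp: isomorphic_ringed_spaces_def)
  with idempotent_axioms e(3) show ?thesis by (intro that[of e]) auto
qed

lemma unit_additive_clopen:
  assumes "unit_additive X" and W: "openin (points X) W" "closedin (points X) W"
  shows "unit_additive (open_subspace X W)"
proof -
  obtain R :: "'b ring" and f \<phi> where R: "unit_additive_ring R" and iso: "iso_ringed_spaces X (Spec R) f \<phi>"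
    using assms(1) by (auto simp: unit_additive_def isomorphic_ringed_spaces_def)
  have "cring R" using R by (simp add: unit_additive_ring_def)
  then obtain e where "idempotent R e"
    and "isomorphic_ringed_spaces (open_subspace X W) (Spec (corner R e))"
    using iso W by (rule iso_clopen_corner)
  then show ?thesis
    unfolding unit_additive_def using idempotent.unit_additive_corner[OF _ R] by blast
qed

text \<open>Injectivity of an isomorphism on sections applies only to elements of the carrier; this
  lemma places there the product of a constant section with its candidate inverse.\<close>

lemma (in cring) mult_const_section_closed:
  assumes V: "zariski_open R V" and t: "t \<in> carrier (structure_ring R V)" and w: "w \<in> carrier R"
  shows "t \<otimes>\<^bsub>structure_ring R V\<^esub> const_section R V w \<in> carrier (structure_ring R V)"
proof -
  let ?s = "t \<otimes>\<^bsub>structure_ring R V\<^esub> const_section R V w"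
  have t: "t \<in> regular_functions R V" using t by (simp add: structure_ring_def)
  have loc: "\<exists>W a g. zariski_open R W \<and> p \<in> W \<and> W \<subseteq> V \<and> a \<in> carrier R \<and> g \<in> carrier R \<and>
      (\<forall>q\<in>W. g \<notin> q \<and> ?s q = fraction_at R q a g)" if p: "p \<in> V" for p
  proof -
    obtain W a g where W: "zariski_open R W" "p \<in> W" "W \<subseteq> V" "a \<in> carrier R" "g \<in> carrier R"
      "\<And>q. q \<in> W \<Longrightarrow> g \<notin> q" "\<And>q. q \<in> W \<Longrightarrow> t q = fraction_at R q a g"
      using t p by (rule regular_functionsE) blast
    have "g \<notin> q \<and> ?s q = fraction_at R q (a \<otimes> w) g" if q: "q \<in> W" for q
    proof -
      interpret q: primeideal q R using W(1) q by (rule zariski_openD)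
      show ?thesis using q W w q.loc.one_in_S
        by (auto simp: structure_ring_def const_section_def q.loc.mult_fraction)
    qed
    then show ?thesis using W w
      by (intro exI[of _ W] exI[of _ "a \<otimes> w"] exI[of _ g]) auto
  qed
  have "?s p \<in> carrier (loc_at R p)" if p: "p \<in> V" for p
  proof -
    interpret p: primeideal p R using V p by (rule zariski_openD)
    obtain a g where "a \<in> carrier R" "g \<in> carrier R" "g \<notin> p" "?s p = fraction_at R p a g"
      using loc[OF p] by blast
    then show ?thesis using p.loc.fraction_closed by simp
  qed
  moreover have "?s \<in> extensional V" by (simp add: structure_ring_def)
  moreover have "\<exists>W. zariski_open R W \<and> p \<in> W \<and> W \<subseteq> V \<and>
      (\<exists>a\<in>carrier R. \<exists>g\<in>carrier R. \<forall>q\<in>W. g \<notin> q \<and> ?s q = fraction_at R q a g)"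
    if "p \<in> V" for p
    using loc[OF that] by meson
  ultimately have "?s \<in> regular_functions R V"
    unfolding regular_functions_def by (auto simp: PiE_def)
  then show ?thesis by (simp add: structure_ring_def)
qed

text \<open>The inverse t pulls back along the isomorphism, which reduces the claim to sections on
  the spectrum. S will be the ring of sections of X in which R and A meet.\<close>

lemma (in cring) iso_sections_unit_notin:
  assumes V: "zariski_open R V" and \<phi>: "\<phi> \<in> ring_iso (structure_ring R V) S"
    and w: "w \<in> carrier R" and t: "t \<in> carrier S"
    and eq: "t \<otimes>\<^bsub>S\<^esub> \<phi> (const_section R V w) = \<one>\<^bsub>S\<^esub>"
    and p: "p \<in> V"
  shows "w \<notin> p"
proof -
  have hom: "\<phi> \<in> ring_hom (structure_ring R V) S"
    and bij: "bij_betw \<phi> (carrier (structure_ring R V)) (carrier S)"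
    using \<phi> by (auto simp: ring_iso_def)
  note const = const_section_hom[OF V]
  obtain t' where t': "t' \<in> carrier (structure_ring R V)" "\<phi> t' = t"
    using bij t by (metis bij_betw_imp_surj_on imageE)
  have "\<phi> (t' \<otimes>\<^bsub>structure_ring R V\<^esub> const_section R V w) = \<phi> \<one>\<^bsub>structure_ring R V\<^esub>"
    using ring_hom_mult[OF hom t'(1) ring_hom_closed[OF const w]] ring_hom_one[OF hom] t'(2) eq by simp
  moreover have "\<one>\<^bsub>structure_ring R V\<^esub> \<in> carrier (structure_ring R V)"
    using ring_hom_closed[OF const one_closed] ring_hom_one[OF const] by simp
  ultimately have "t' \<otimes>\<^bsub>structure_ring R V\<^esub> const_section R V w = \<one>\<^bsub>structure_ring R V\<^esub>"
    using bij mult_const_section_closed[OF V t'(1) w] by (auto simp: bij_betw_def inj_on_def)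
  then show ?thesis by (rule const_section_unit_notin[OF V w t'(1) _ p])
qed

lemma (in cring) iso_sections_zero_in:
  assumes V: "zariski_open R V" and \<phi>: "\<phi> \<in> ring_iso (structure_ring R V) S" and S: "ring S"
    and w: "w \<in> carrier R" and eq: "\<phi> (const_section R V w) = \<zero>\<^bsub>S\<^esub>"
    and p: "p \<in> V"
  shows "w \<in> p"
proof -
  have hom: "\<phi> \<in> ring_hom (structure_ring R V) S"
    and bij: "bij_betw \<phi> (carrier (structure_ring R V)) (carrier S)"
    using \<phi> by (auto simp: ring_iso_def)
  note const = const_section_hom[OF V]
  \<comment> \<open>Preservation of zero is taken from the composite map from R to S, both ends of
    which are known to be rings.\<close>
  have "\<phi> (const_section R V w) = \<phi> (const_section R V \<zero>)"
    using ring_hom_zero[OF ring_hom_trans[OF const hom] ring_axioms S] eq by simp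
  then have "const_section R V w = const_section R V \<zero>"
    using bij ring_hom_closed[OF const] w by (auto simp: bij_betw_def inj_on_def)
  also have "\<dots> = \<zero>\<^bsub>structure_ring R V\<^esub>"
    by (simp add: structure_ring_def const_section_def zero_localization)
  finally show ?thesis by (rule const_section_zero_in[OF V w _ p])
qed

text \<open>Both \<open>R\<close> and the coordinate ring \<open>A\<close> of \<open>U\<close> map to the sections over \<open>U\<close>, the latter
  surjectively; so units of \<open>R\<close> can be lifted to units of \<open>A\<close>.\<close>

lemma unit_sum_dichotomy:
  fixes X :: "('a, 'b) ringed_space" and R :: "('r, 'm) ring_scheme"
  assumes X: "presheaf_of_rings X" and R: "cring R" and iso: "iso_ringed_spaces X (Spec R) f \<phi>"
    and U: "openin (points X) U" and UA: "unit_additive (open_subspace X U)"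
    and u: "u \<in> Units R" and v: "v \<in> Units R"
  shows "(\<forall>x\<in>U. u \<oplus>\<^bsub>R\<^esub> v \<notin> f x) \<or> (\<forall>x\<in>U. u \<oplus>\<^bsub>R\<^esub> v \<in> f x)"
proof -
  interpret R: cring R by (rule R)
  define S where "S = sections X U"
  have "cring S" using X U by (simp add: presheaf_of_rings_def S_def)
  then interpret S: cring S .
  obtain A :: "'b ring" and g \<gamma> where A: "unit_additive_ring A"
    and isoA: "iso_ringed_spaces (open_subspace X U) (Spec A) g \<gamma>"
    using UA by (auto simp: unit_additive_def isomorphic_ringed_spaces_def)
  interpret A: cring A using A by (simp add: unit_additive_ring_def)
  have sub: "U \<subseteq> topspace (points X)" using U by (rule openin_subset)
  have hom: "homeomorphic_map (points X) (zariski_topology R) f"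
    using iso by (auto simp: iso_ringed_spaces_def Spec_def)
  have V: "zariski_open R (f ` U)"
    using hom U homeomorphic_map_openness sub by (metis openin_zariski_topology)
  have "inj_on f (topspace (points X))"
    using hom by (auto simp: homeomorphic_eq_everything_map)
  \<comment> \<open>Injectivity of f makes \<open>\<phi>\<close> land in the sections over U
    itself.\<close>
  then have "f -` (f ` U) \<inter> topspace (points X) = U"
    using sub by (auto simp: inj_on_def)
  then have \<phi>: "\<phi> (f ` U) \<in> ring_iso (structure_ring R (f ` U)) S"
    using iso V by (auto simp: iso_ringed_spaces_def Spec_def openin_zariski_topology S_def)
  define W where "W = prime_ideals A"
  have W: "zariski_open A W"
    using openin_topspace[of "zariski_topology A"] by (simp add: W_def topspace_zariski openin_zariski_topology)
  have homA: "homeomorphic_map (subtopology (points X) U) (zariski_topology A) g"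
    using isoA by (auto simp: iso_ringed_spaces_def Spec_def open_subspace_def)
  then have "g ` U = W"
    using sub by (auto simp: homeomorphic_eq_everything_map topspace_zariski W_def Int_absorb1)
  then have "g -` W \<inter> topspace (points (open_subspace X U)) = U"
    using sub by (auto simp: open_subspace_def)
  moreover have "\<gamma> W \<in> ring_iso (sections (Spec A) W)
      (sections (open_subspace X U) (g -` W \<inter> topspace (points (open_subspace X U))))"
    using isoA W by (simp add: iso_ringed_spaces_def Spec_def openin_zariski_topology)
  ultimately have \<gamma>: "\<gamma> W \<in> ring_iso (structure_ring A W) S"
    by (simp add: Spec_def open_subspace_def S_def)
  define \<theta> where "\<theta> = \<phi> (f ` U) \<circ> const_section R (f ` U)"
  define \<eta> where "\<eta> = \<gamma> W \<circ> const_section A W"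
  have \<theta>: "\<theta> \<in> ring_hom R S" and \<eta>: "\<eta> \<in> ring_hom A S"
    unfolding \<theta>_def \<eta>_def using \<phi> \<gamma> R.const_section_hom[OF V] A.const_section_hom[OF W]
    by (auto simp: ring_iso_def intro: ring_hom_trans)
  interpret \<theta>: ring_hom_cring R S \<theta> by unfold_locales (rule \<theta>)
  interpret \<eta>: ring_hom_cring A S \<eta> by unfold_locales (rule \<eta>)
  have surj: "\<exists>a\<in>carrier A. \<eta> a = s" if "s \<in> carrier S" for s
  proof -
    have "s \<in> \<gamma> W ` carrier (structure_ring A W)"
      using \<gamma> that by (simp add: ring_iso_def bij_betw_def)
    then obtain \<sigma> where "\<sigma> \<in> carrier (structure_ring A W)" "\<gamma> W \<sigma> = s" by blast
    moreover from this obtain a where "a \<in> carrier A" "\<sigma> = const_section A W a"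
      using A.global_section_const by (auto simp: structure_ring_def W_def)
    ultimately show ?thesis by (auto simp: \<eta>_def)
  qed
  \<comment> \<open>Any preimage a will do: its image is invertible in S, so a lies in no prime of A
    and is a unit.\<close>
  have unit_lift: "\<exists>a\<in>Units A. \<eta> a = \<theta> r" if r: "r \<in> Units R" for r
  proof -
    have rc: "r \<in> carrier R" "inv\<^bsub>R\<^esub> r \<in> carrier R" using r by auto
    obtain a where a: "a \<in> carrier A" "\<eta> a = \<theta> r" using surj[of "\<theta> r"] rc by auto
    have "\<theta> (inv\<^bsub>R\<^esub> r) \<otimes>\<^bsub>S\<^esub> \<eta> a = \<one>\<^bsub>S\<^esub>"
      using r rc a(2) by (simp flip: \<theta>.hom_mult)
    then have "a \<notin> p" if "primeideal p A" for p
      using A.iso_sections_unit_notin[OF W \<gamma> a(1), of "\<theta> (inv\<^bsub>R\<^esub> r)" p] rc that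
      by (simp add: \<eta>_def W_def prime_ideals_def)
    then show ?thesis using a A.unit_if_in_no_prime[OF a(1)] by blast
  qed
  define w where "w = u \<oplus>\<^bsub>R\<^esub> v"
  have w: "w \<in> carrier R" using u v by (auto simp: w_def)
  obtain a b where ab: "a \<in> Units A" "b \<in> Units A" "\<eta> a = \<theta> u" "\<eta> b = \<theta> v"
    using unit_lift u v by meson
  define c where "c = a \<oplus>\<^bsub>A\<^esub> b"
  have c: "c \<in> carrier A" using ab by (auto simp: c_def)
  have "\<eta> c = \<theta> w" using ab u v by (simp add: c_def w_def A.Units_closed R.Units_closed)
  have "c \<in> Units A \<or> nilpotent_elem A c"
    using A ab unfolding unit_additive_ring_def c_def by blast
  then have "(\<forall>p\<in>f ` U. w \<notin> p) \<or> (\<forall>p\<in>f ` U. w \<in> p)"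
  proof
    assume cu: "c \<in> Units A"
    then have "\<eta> (inv\<^bsub>A\<^esub> c) \<otimes>\<^bsub>S\<^esub> \<theta> w = \<one>\<^bsub>S\<^esub>"
      using c by (simp flip: \<open>\<eta> c = \<theta> w\<close> \<eta>.hom_mult)
    then have "w \<notin> p" if "p \<in> f ` U" for p
      using R.iso_sections_unit_notin[OF V \<phi> w, of "\<eta> (inv\<^bsub>A\<^esub> c)" p] cu that by (simp add: \<theta>_def)
    then show ?thesis by blast
  next
    assume "nilpotent_elem A c"
    then obtain n :: nat where n: "0 < n" "c [^]\<^bsub>A\<^esub> n = \<zero>\<^bsub>A\<^esub>" by (auto simp: nilpotent_elem_def)
    \<comment> \<open>Nilpotency passes through S: w^n has image zero there, so all primes in the
      image of U contain w^n and hence w.\<close>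
    have "\<theta> (w [^]\<^bsub>R\<^esub> n) = \<eta> (c [^]\<^bsub>A\<^esub> n)"
      using w c \<open>\<eta> c = \<theta> w\<close> by (simp add: \<theta>.ring.hom_nat_pow \<eta>.ring.hom_nat_pow)
    then have "\<phi> (f ` U) (const_section R (f ` U) (w [^]\<^bsub>R\<^esub> n)) = \<zero>\<^bsub>S\<^esub>"
      by (simp add: n(2) \<theta>_def)
    then have "w [^]\<^bsub>R\<^esub> n \<in> p" if "p \<in> f ` U" for p
      using R.iso_sections_zero_in[OF V \<phi> S.ring_axioms, of "w [^]\<^bsub>R\<^esub> n" p] w that by simp
    then have "w \<in> p" if "p \<in> f ` U" for p
      using that primeideal.pow_mem_iff[OF zariski_openD[OF V that] w n(1)] by blast
    then show ?thesis by blast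
  qed
  then show ?thesis by (auto simp: w_def)
qed

text \<open>By the dichotomy each member of the cover lies in T or misses it, so both T and its
  complement are unions of members.\<close>

lemma unit_sum_nonvanishing_clopen:
  fixes X :: "('a, 'b) ringed_space"
  assumes X: "presheaf_of_rings X" "locally_unit_additive X"
    and R: "cring R" and iso: "iso_ringed_spaces X (Spec R) f \<phi>"
    and u: "u \<in> Units R" and v: "v \<in> Units R"
  defines "T \<equiv> {x \<in> topspace (points X). u \<oplus>\<^bsub>R\<^esub> v \<notin> f x}"
  shows "openin (points X) T" "closedin (points X) T"
proof -
  obtain \<U> where "\<forall>U\<in>\<U>. openin (points X) U \<and> unit_additive (open_subspace X U)"
    "\<Union>\<U> = topspace (points X)"
    using X(2) unfolding locally_unit_additive_def by (elim exE conjE)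
  then have \<U>: "\<And>U. U \<in> \<U> \<Longrightarrow> openin (points X) U"
    "\<And>U. U \<in> \<U> \<Longrightarrow> unit_additive (open_subspace X U)" "\<Union>\<U> = topspace (points X)"
    by simp_all
  have dich: "U \<subseteq> T \<or> U \<inter> T = {}" if "U \<in> \<U>" for U
    using unit_sum_dichotomy[OF X(1) R iso \<U>(1,2)[OF that] u v] \<U>(3) that
    unfolding T_def by blast
  have T: "T \<subseteq> topspace (points X)" by (auto simp: T_def)
  have "x \<in> \<Union>{U \<in> \<U>. U \<subseteq> T}" if "x \<in> T" for x
  proof -
    have "x \<in> \<Union>\<U>" unfolding \<U>(3) using T that by (rule subsetD)
    then obtain U where U: "U \<in> \<U>" "x \<in> U" by (rule UnionE)
    then show ?thesis using dich[OF U(1)] that by auto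
  qed
  then have 1: "T = \<Union>{U \<in> \<U>. U \<subseteq> T}" by blast
  have "x \<in> \<Union>{U \<in> \<U>. U \<inter> T = {}}" if "x \<in> topspace (points X)" "x \<notin> T" for x
  proof -
    have "x \<in> \<Union>\<U>" unfolding \<U>(3) by (rule that(1))
    then obtain U where U: "U \<in> \<U>" "x \<in> U" by (rule UnionE)
    then show ?thesis using dich[OF U(1)] that(2) by auto
  qed
  moreover have "\<Union>{U \<in> \<U>. U \<inter> T = {}} \<subseteq> topspace (points X) - T"
    unfolding \<U>(3)[symmetric] by blast
  ultimately have 2: "topspace (points X) - T = \<Union>{U \<in> \<U>. U \<inter> T = {}}" by blast
  show "openin (points X) T"
    by (subst 1) (use \<U>(1) in auto)
  have "openin (points X) (topspace (points X) - T)"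
    unfolding 2 using \<U>(1) by auto
  then show "closedin (points X) T"
    using T by (simp add: closedin_def)
qed

lemma unit_additive_component:
  fixes X :: "('a, 'b) ringed_space"
  assumes X: "presheaf_of_rings X" "locally_unit_additive X" "affine_scheme X"
    and C: "openin (points X) C" "closedin (points X) C" "connectedin (points X) C"
  shows "unit_additive (open_subspace X C)"
proof -
  obtain R :: "'b ring" and f \<phi> where R: "cring R" and iso: "iso_ringed_spaces X (Spec R) f \<phi>"
    using X(3) by (auto simp: affine_scheme_def isomorphic_ringed_spaces_def)
  obtain e where "idempotent R e" and fC: "f ` C = basic_open R e"
    and isoC: "isomorphic_ringed_spaces (open_subspace X C) (Spec (corner R e))"
    using R iso C(1,2) by (rule iso_clopen_corner)
  interpret idempotent R e by fact
  have "unit_additive_ring (corner R e)"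
    unfolding unit_additive_ring_def
  proof (intro conjI cring_corner ballI)
    fix u v assume uv: "u \<in> Units (corner R e)" "v \<in> Units (corner R e)"
    define w where "w = u \<oplus>\<^bsub>R\<^esub> v"
    have wE: "w \<in> E" unfolding w_def using uv by (rule corner_add_Units)
    note w = E_carrier[OF wE]
    obtain u' v' where uv': "u' \<in> Units R" "v' \<in> Units R" "u' \<oplus>\<^bsub>R\<^esub> v' = w"
      unfolding w_def using uv by (rule units_lift)
    define T where "T = {x \<in> topspace (points X). w \<notin> f x}"
    have "openin (points X) T" "closedin (points X) T"
      using unit_sum_nonvanishing_clopen[OF X(1,2) R iso uv'(1,2)] by (simp_all add: T_def uv'(3))
    then consider "C \<subseteq> T" | "disjnt C T"
      using connectedin_clopen_cases[OF C(3)] by blast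
    then have "w \<in> Units (corner R e) \<or> nilpotent_elem (corner R e) w"
    proof cases
      case 1
      \<comment> \<open>On D(e), the image of C, the element w vanishes nowhere; so every prime
        containing w contains e, and w divides a power of e.\<close>
      have "e \<in> p" if p: "primeideal p R" "w \<in> p" for p
      proof (rule ccontr)
        assume "e \<notin> p"
        then have "p \<in> f ` C" using p fC by (simp add: basic_open_def)
        then show False using 1 p(2) by (auto simp: T_def)
      qed
      from radical_member_principal[OF w e_carrier this]
      obtain n :: nat and c where c: "c \<in> carrier R" "e [^]\<^bsub>R\<^esub> n = c \<otimes>\<^bsub>R\<^esub> w" by blast
      \<comment> \<open>The extra factor e covers the exponent 0.\<close>
      have "e \<otimes>\<^bsub>R\<^esub> e [^]\<^bsub>R\<^esub> n = e"
        by (induction n) (simp_all add: e_idem flip: m_assoc)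
      then have "(e \<otimes>\<^bsub>R\<^esub> c) \<otimes>\<^bsub>R\<^esub> w = e" using c w by (simp add: m_assoc)
      then have "w \<in> Units (corner R e)" using c(1) by (intro corner_unitI[OF wE, of "e \<otimes>\<^bsub>R\<^esub> c"]) auto
      then show ?thesis ..
    next
      case 2
      \<comment> \<open>Off D(e) the prime contains e and hence w = ew; on D(e) it comes from a
        point of C, where w vanishes.\<close>
      have "w \<in> p" if p: "primeideal p R" for p
      proof (cases "e \<in> p")
        case True
        interpret p: primeideal p R by (rule p)
        show ?thesis using p.I_r_closed[OF True w] E_absorb[OF wE] by simp
      next
        case False
        then have "p \<in> f ` C" using p fC by (simp add: basic_open_def)
        then show ?thesis using 2 openin_subset[OF C(1)] by (auto simp: T_def disjnt_iff)
      qed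
      then show ?thesis using corner_nilpotent[OF wE nilpotent_if_in_all_primes[OF w]] by blast
    qed
    then show "u \<oplus>\<^bsub>corner R e\<^esub> v \<in> Units (corner R e)
        \<or> nilpotent_elem (corner R e) (u \<oplus>\<^bsub>corner R e\<^esub> v)"
      by (simp add: w_def)
  qed
  with isoC show ?thesis unfolding unit_additive_def by blast
qed

section \<open>Covers and connected components\<close>

lemma open_subspace_open_subspace:
  "open_subspace (open_subspace X U) V = open_subspace X (U \<inter> V)"
  by (simp add: open_subspace_def subtopology_subtopology)

lemma points_open_subspace: "points (open_subspace X U) = subtopology (points X) U"
  by (simp add: open_subspace_def)

lemma locally_unit_additive_clopen:
  assumes X: "locally_unit_additive X" and C: "openin (points X) C" "closedin (points X) C"
  shows "locally_unit_additive (open_subspace X C)"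
proof -
  obtain \<U> where "\<forall>U\<in>\<U>. openin (points X) U \<and> unit_additive (open_subspace X U)"
    "\<Union>\<U> = topspace (points X)"
    using X unfolding locally_unit_additive_def by (elim exE conjE)
  then have \<U>: "\<And>U. U \<in> \<U> \<Longrightarrow> openin (points X) U"
    "\<And>U. U \<in> \<U> \<Longrightarrow> unit_additive (open_subspace X U)" "\<Union>\<U> = topspace (points X)"
    by simp_all
  have "openin (points (open_subspace X C)) (U \<inter> C)
      \<and> unit_additive (open_subspace (open_subspace X C) (U \<inter> C))" if U: "U \<in> \<U>" for U
  proof
    show "openin (points (open_subspace X C)) (U \<inter> C)"
      using \<U>(1)[OF U] by (auto simp: points_open_subspace openin_subtopology)
    \<comment> \<open>The trace on U of a clopen C is clopen in U, so
      \<open>unit_additive_clopen\<close> applies to U.\<close>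
    have "openin (subtopology (points X) U) (U \<inter> C)" "closedin (subtopology (points X) U) (U \<inter> C)"
      using C by (auto simp: openin_subtopology closedin_subtopology)
    then have "unit_additive (open_subspace (open_subspace X U) (U \<inter> C))"
      by (intro unit_additive_clopen[OF \<U>(2)[OF U]]) (simp_all add: points_open_subspace)
    then show "unit_additive (open_subspace (open_subspace X C) (U \<inter> C))"
      by (simp add: open_subspace_open_subspace Int_ac)
  qed
  moreover have "\<Union>((\<lambda>U. U \<inter> C) ` \<U>) = topspace (points (open_subspace X C))"
    using \<U>(3) by (auto simp: points_open_subspace)
  ultimately show ?thesis
    unfolding locally_unit_additive_def by (intro exI[of _ "(\<lambda>U. U \<inter> C) ` \<U>"]) auto
qed

lemma locally_unit_additive_Union:
  assumes open_cover: "\<And>C. C \<in> \<C> \<Longrightarrow> openin (points X) C" "\<Union>\<C> = topspace (points X)"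
    and lua: "\<And>C. C \<in> \<C> \<Longrightarrow> locally_unit_additive (open_subspace X C)"
  shows "locally_unit_additive X"
proof -
  \<comment> \<open>Taking all unit-additive open sets avoids choosing a cover for each C.\<close>
  define \<U> where "\<U> = {U. openin (points X) U \<and> unit_additive (open_subspace X U)}"
  have "C \<subseteq> \<Union>\<U>" if C: "C \<in> \<C>" for C
  proof
    fix x assume x: "x \<in> C"
    obtain \<V> where \<V>: "\<forall>V\<in>\<V>. openin (subtopology (points X) C) V \<and> unit_additive (open_subspace X (C \<inter> V))"
      "\<Union>\<V> = topspace (subtopology (points X) C)"
      using lua[OF C] by (auto simp: locally_unit_additive_def points_open_subspace open_subspace_open_subspace)
    have "x \<in> \<Union>\<V>" using x openin_subset[OF open_cover(1)[OF C]] by (auto simp: \<V>(2))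
    then obtain V where V: "V \<in> \<V>" "x \<in> V" by blast
    then have "openin (points X) V" "V \<subseteq> C"
      using \<V>(1) open_cover(1)[OF C] by (auto simp: openin_open_subtopology)
    then have "V \<in> \<U>" using V(1) \<V>(1) by (auto simp: \<U>_def Int_absorb1)
    then show "x \<in> \<Union>\<U>" using V(2) by blast
  qed
  moreover have "\<Union>\<U> \<subseteq> topspace (points X)" using openin_subset by (auto simp: \<U>_def)
  ultimately have "\<Union>\<U> = topspace (points X)" using open_cover(2) by blast
  then show ?thesis unfolding locally_unit_additive_def by (intro exI[of _ \<U>]) (simp add: \<U>_def)
qed

lemma locally_unit_additive_if_unit_additive:
  assumes "unit_additive X"
  shows "locally_unit_additive X"
proof -
  have "open_subspace X (topspace (points X)) = X"
    by (simp add: open_subspace_def)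
  then show ?thesis
    using assms unfolding locally_unit_additive_def
    by (intro exI[of _ "{topspace (points X)}"]) simp
qed

theorem proposition3p14:
  fixes X :: "('a, 'b) ringed_space"
  assumes "scheme X"
    and "compact_space (points X)"
    and "finite (connected_components_of (points X))"
  shows "(locally_unit_additive X \<longleftrightarrow>
           (\<forall>C\<in>connected_components_of (points X). locally_unit_additive (open_subspace X C))) \<and>
         (affine_scheme X \<longrightarrow>
           (locally_unit_additive X \<longleftrightarrow>
             (\<forall>C\<in>connected_components_of (points X). unit_additive (open_subspace X C))))"
proof -
  have presheaf: "presheaf_of_rings X"
    using assms(1) by (simp add: scheme_def locally_ringed_space_def is_ringed_space_def)
  \<comment> \<open>Components are always closed; being finitely many, they are open as
    well.\<close>
  have C: "openin (points X) C" "closedin (points X) C" "connectedin (points X) C"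
    if "C \<in> connected_components_of (points X)" for C
    using that open_in_finite_connected_components[OF assms(3)]
    by (auto simp: closedin_connected_components_of connectedin_connected_components_of)
  have ab: "locally_unit_additive X \<longleftrightarrow>
      (\<forall>C\<in>connected_components_of (points X). locally_unit_additive (open_subspace X C))"
    using locally_unit_additive_clopen[of X] C
      locally_unit_additive_Union[OF C(1) Union_connected_components_of]
    by blast
  have "locally_unit_additive X \<longleftrightarrow>
      (\<forall>C\<in>connected_components_of (points X). unit_additive (open_subspace X C))"
    if "affine_scheme X"
    using ab unit_additive_component[OF presheaf _ that C] locally_unit_additive_if_unit_additive
    by blast
  with ab show ?thesis by blast
qed

end
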